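(* Let $A$ be a noetherian integral domain containing $\mathbb{R}$ such that $\mathbb{R}$ is algebraically closed in $A$, and suppose that $B=\mathbb{C}\otimes_{\mathbb{R}}A=A[i]$ is an integral domain. Suppose that $B$ is a UFD. Then the following conditions are equivalent. (1) Every element of $B'=B\setminus\{0\}$ has a unique polar factorization up to units. (2) For every $f\in B'$: $f\in\Delta(B)$ if and only if $\gcd(f,\bar f)=1$ in $B$. (3) For all $f,g\in\Delta(B)$: $[f]=[g]$ in $\Pi(A)$ if and only if $fB=gB$. (4) $\Pi(A)$ is square-torsion free, i.e. $\gamma\in\Pi(A)$ and $\gamma^2=1$ imply $\gamma=1$. (5) $\Pi(A)$ is torsion free. (6) $\Pi(A)$ is a free abelian group. Moreover, when these conditions hold, a basis of $\Pi(A)$ is given by a transversal generating set $[\mathcal{T}]=\{[f] : f\in\mathcal{T}\}$, where $\mathcal{T}$ is a transversal of the action of $\Gamma$ on $\Delta(B)_1$.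
   Context: For a ring $R$, $R^*$ is its unit group and $R'=R\setminus\{0\}$. Every $f\in B$ is uniquely $f=f_1+if_2$ with $f_1,f_2\in A$; its conjugate is $\bar f=f_1-if_2$. Let $K=\mathrm{frac}(A)$ and $L=\mathrm{frac}(B)=K[i]$. The polar group of $A$ is $\Pi(A)=L^*/B^*K^*$, and for $f\in B'$, $[f]$ denotes the class of $f$ in $\Pi(A)$. (For $f,g\in B'$, $[f]=[g]$ iff $f\bar g\in B^*\cdot A'$; $[f]^{-1}=[\bar f]$.) An element $f\in B'$ has no real divisor if $f\in rB$ with $r\in A'$ implies $r\in A^*$; $\Delta(B)$ is the set of elements of $B'$ with no real divisor, and $\Delta(B)_1$ is the set of irreducible elements of $B$ lying in $\Delta(B)$. A polar factorization of $f\in B'$ is a factorization $f=\alpha h$ with $\alpha\in A'$ and $h\in\Delta(B)$. It is unique up to units if whenever $f=\alpha h=\beta g$ are two polar factorizations, then $\alpha A=\beta A$ and $hB=gB$. The group $\Gamma=B^*\rtimes\mathbb{Z}_2$ acts on $B'$, with $B^*$ acting by multiplication and $\mathbb{Z}_2$ acting by $f\mapsto\bar f$; this action restricts to $\Delta(B)_1$. A transversal of this action on $\Delta(B)_1$ is a set containing exactly one element of each orbit. *)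

theory Defs
  imports Complex_Main "HOL-Algebra.Algebra" "HOL-Algebra.Algebraic_Closure_Type"
begin

section \<open>The complexification \<open>B = A[i]\<close>\<close>

text \<open>Since \<open>1, i\<close> is a basis of \<open>\<complex>\<close> over \<open>\<real>\<close>, the ring \<open>\<complex> \<otimes>\<^sub>\<real> A\<close> is
  \<open>A \<oplus> iA\<close>; the pair \<open>(a, b)\<close> stands for \<open>a + ib\<close>.\<close>

definition complexify :: "('a, 'm) ring_scheme \<Rightarrow> ('a \<times> 'a) ring" where
  "complexify A =
    \<lparr>carrier = carrier A \<times> carrier A,
     monoid.mult = (\<lambda>(a, b) (c, d).
       ((a \<otimes>\<^bsub>A\<^esub> c) \<ominus>\<^bsub>A\<^esub> (b \<otimes>\<^bsub>A\<^esub> d), (a \<otimes>\<^bsub>A\<^esub> d) \<oplus>\<^bsub>A\<^esub> (b \<otimes>\<^bsub>A\<^esub> c))),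
     one = (\<one>\<^bsub>A\<^esub>, \<zero>\<^bsub>A\<^esub>),
     ring.zero = (\<zero>\<^bsub>A\<^esub>, \<zero>\<^bsub>A\<^esub>),
     add = (\<lambda>(a, b) (c, d). (a \<oplus>\<^bsub>A\<^esub> c, b \<oplus>\<^bsub>A\<^esub> d))\<rparr>"

definition embed :: "('a, 'm) ring_scheme \<Rightarrow> 'a \<Rightarrow> 'a \<times> 'a" where
  "embed A a = (a, \<zero>\<^bsub>A\<^esub>)"

definition conjugate :: "('a, 'm) ring_scheme \<Rightarrow> 'a \<times> 'a \<Rightarrow> 'a \<times> 'a" where
  "conjugate A f = (fst f, \<ominus>\<^bsub>A\<^esub> snd f)"

definition nonzero :: "('a, 'm) ring_scheme \<Rightarrow> 'a set" where
  "nonzero R = carrier R - {\<zero>\<^bsub>R\<^esub>}"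


section \<open>Field of fractions\<close>

definition frac_rel :: "('a, 'm) ring_scheme \<Rightarrow> (('a \<times> 'a) \<times> ('a \<times> 'a)) set" where
  "frac_rel R = {((a, b), (c, d)).
     (a, b) \<in> carrier R \<times> nonzero R \<and> (c, d) \<in> carrier R \<times> nonzero R \<and>
     a \<otimes>\<^bsub>R\<^esub> d = c \<otimes>\<^bsub>R\<^esub> b}"

definition fraction :: "('a, 'm) ring_scheme \<Rightarrow> 'a \<Rightarrow> 'a \<Rightarrow> ('a \<times> 'a) set" where
  "fraction R a b = frac_rel R `` {(a, b)}"

text \<open>In the operations all sets united coincide when \<open>R\<close> is an integral domain.\<close>

definition fraction_field :: "('a, 'm) ring_scheme \<Rightarrow> ('a \<times> 'a) set ring" where
  "fraction_field R =
    \<lparr>carrier = {fraction R a b | a b. a \<in> carrier R \<and> b \<in> nonzero R},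
     monoid.mult = (\<lambda>p q. \<Union>(a, b)\<in>p. \<Union>(c, d)\<in>q. fraction R (a \<otimes>\<^bsub>R\<^esub> c) (b \<otimes>\<^bsub>R\<^esub> d)),
     one = fraction R \<one>\<^bsub>R\<^esub> \<one>\<^bsub>R\<^esub>,
     ring.zero = fraction R \<zero>\<^bsub>R\<^esub> \<one>\<^bsub>R\<^esub>,
     add = (\<lambda>p q. \<Union>(a, b)\<in>p. \<Union>(c, d)\<in>q.
       fraction R ((a \<otimes>\<^bsub>R\<^esub> d) \<oplus>\<^bsub>R\<^esub> (c \<otimes>\<^bsub>R\<^esub> b)) (b \<otimes>\<^bsub>R\<^esub> d))\<rparr>"


section \<open>The polar group \<open>\<Pi>(A) = L\<^sup>* / B\<^sup>*K\<^sup>*\<close>\<close>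

text \<open>\<open>L = frac(B)\<close>, and \<open>K = frac(A)\<close> is identified with its image in \<open>L\<close>.\<close>

definition L_units :: "('a, 'm) ring_scheme \<Rightarrow> (('a \<times> 'a) \<times> ('a \<times> 'a)) set monoid" where
  "L_units A = units_of (fraction_field (complexify A))"

definition B_units_in_L :: "('a, 'm) ring_scheme \<Rightarrow> (('a \<times> 'a) \<times> ('a \<times> 'a)) set set" where
  "B_units_in_L A =
    {fraction (complexify A) u \<one>\<^bsub>complexify A\<^esub> | u. u \<in> Units (complexify A)}"

definition K_units_in_L :: "('a, 'm) ring_scheme \<Rightarrow> (('a \<times> 'a) \<times> ('a \<times> 'a)) set set" where
  "K_units_in_L A =
    {fraction (complexify A) (embed A a) (embed A b) | a b. a \<in> nonzero A \<and> b \<in> nonzero A}"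

definition polar_kernel :: "('a, 'm) ring_scheme \<Rightarrow> (('a \<times> 'a) \<times> ('a \<times> 'a)) set set" where
  "polar_kernel A = B_units_in_L A <#>\<^bsub>L_units A\<^esub> K_units_in_L A"

definition polar_group :: "('a, 'm) ring_scheme \<Rightarrow> (('a \<times> 'a) \<times> ('a \<times> 'a)) set set monoid" where
  "polar_group A = L_units A Mod polar_kernel A"

definition polar_class :: "('a, 'm) ring_scheme \<Rightarrow> 'a \<times> 'a \<Rightarrow> (('a \<times> 'a) \<times> ('a \<times> 'a)) set set" where
  "polar_class A f =
    polar_kernel A #>\<^bsub>L_units A\<^esub> fraction (complexify A) f \<one>\<^bsub>complexify A\<^esub>"


section \<open>Real divisors and polar factorizations\<close>

definition Delta :: "('a, 'm) ring_scheme \<Rightarrow> ('a \<times> 'a) set" where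
  "Delta A = {f \<in> nonzero (complexify A).
     \<forall>r \<in> nonzero A. f \<in> PIdl\<^bsub>complexify A\<^esub> (embed A r) \<longrightarrow> r \<in> Units A}"

definition Delta1 :: "('a, 'm) ring_scheme \<Rightarrow> ('a \<times> 'a) set" where
  "Delta1 A = {f \<in> Delta A. ring_irreducible\<^bsub>complexify A\<^esub> f}"

definition polar_factorization :: "('a, 'm) ring_scheme \<Rightarrow> 'a \<times> 'a \<Rightarrow> 'a \<Rightarrow> 'a \<times> 'a \<Rightarrow> bool" where
  "polar_factorization A f \<alpha> h \<longleftrightarrow>
     \<alpha> \<in> nonzero A \<and> h \<in> Delta A \<and> f = embed A \<alpha> \<otimes>\<^bsub>complexify A\<^esub> h"

definition has_unique_polar_factorization :: "('a, 'm) ring_scheme \<Rightarrow> 'a \<times> 'a \<Rightarrow> bool" where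
  "has_unique_polar_factorization A f \<longleftrightarrow>
     (\<exists>\<alpha> h. polar_factorization A f \<alpha> h) \<and>
     (\<forall>\<alpha> h \<beta> g. polar_factorization A f \<alpha> h \<and> polar_factorization A f \<beta> g \<longrightarrow>
        PIdl\<^bsub>A\<^esub> \<alpha> = PIdl\<^bsub>A\<^esub> \<beta> \<and> PIdl\<^bsub>complexify A\<^esub> h = PIdl\<^bsub>complexify A\<^esub> g)"


section \<open>The group \<open>\<Gamma> = B\<^sup>* \<rtimes> \<int>\<^sub>2\<close> and its action\<close>

definition Z2_act :: "('a, 'm) ring_scheme \<Rightarrow> int \<Rightarrow> 'a \<times> 'a \<Rightarrow> 'a \<times> 'a" where
  "Z2_act A m f = (if m = 0 then f else conjugate A f)"

definition Gamma :: "('a, 'm) ring_scheme \<Rightarrow> (('a \<times> 'a) \<times> int) monoid" where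
  "Gamma A =
    \<lparr>carrier = Units (complexify A) \<times> carrier (integer_mod_group 2),
     monoid.mult = (\<lambda>(u, m) (v, n).
       (u \<otimes>\<^bsub>complexify A\<^esub> Z2_act A m v, m \<otimes>\<^bsub>integer_mod_group 2\<^esub> n)),
     one = (\<one>\<^bsub>complexify A\<^esub>, \<one>\<^bsub>integer_mod_group 2\<^esub>)\<rparr>"

definition Gamma_act :: "('a, 'm) ring_scheme \<Rightarrow> ('a \<times> 'a) \<times> int \<Rightarrow> 'a \<times> 'a \<Rightarrow> 'a \<times> 'a" where
  "Gamma_act A = (\<lambda>(u, m) f. u \<otimes>\<^bsub>complexify A\<^esub> Z2_act A m f)"

definition transversal :: "('a, 'm) ring_scheme \<Rightarrow> ('a \<times> 'a) set \<Rightarrow> bool" where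
  "transversal A T \<longleftrightarrow> T \<subseteq> Delta1 A \<and>
     (\<forall>orb \<in> orbits (Gamma A) (Delta1 A) (Gamma_act A). \<exists>!t. t \<in> T \<and> t \<in> orb)"


section \<open>Group-theoretic notions\<close>

definition square_torsion_free :: "('g, 'm) monoid_scheme \<Rightarrow> bool" where
  "square_torsion_free G \<longleftrightarrow>
     (\<forall>\<gamma> \<in> carrier G. \<gamma> [^]\<^bsub>G\<^esub> (2::nat) = \<one>\<^bsub>G\<^esub> \<longrightarrow> \<gamma> = \<one>\<^bsub>G\<^esub>)"

definition torsion_free :: "('g, 'm) monoid_scheme \<Rightarrow> bool" where
  "torsion_free G \<longleftrightarrow>
     (\<forall>\<gamma> \<in> carrier G. \<forall>n::nat. n > 0 \<and> \<gamma> [^]\<^bsub>G\<^esub> n = \<one>\<^bsub>G\<^esub> \<longrightarrow> \<gamma> = \<one>\<^bsub>G\<^esub>)"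

text \<open>\<open>S\<close> is a basis of \<open>G\<close>: the inclusion of \<open>S\<close> extends to an isomorphism from the free
  abelian group on \<open>S\<close>. The empty set is a basis of the trivial group.\<close>

definition is_free_basis :: "('g, 'm) monoid_scheme \<Rightarrow> 'g set \<Rightarrow> bool" where
  "is_free_basis G S \<longleftrightarrow> S \<subseteq> carrier G \<and>
     (\<exists>h \<in> iso (free_Abelian_group S) G. \<forall>s \<in> S. h (frag_of s) = s)"

definition is_free_abelian :: "('g, 'm) monoid_scheme \<Rightarrow> bool" where
  "is_free_abelian G \<longleftrightarrow> comm_group G \<and> (\<exists>S. is_free_basis G S)"

definition all_equivalent :: "bool list \<Rightarrow> bool" where
  "all_equivalent Ps \<longleftrightarrow> (\<forall>P \<in> set Ps. \<forall>Q \<in> set Ps. P \<longleftrightarrow> Q)"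

end

theory Submission
  imports Defs
begin

text \<open>Conjugation permutes the prime ideals \<open>pB\<close> of the UFD \<open>B\<close>, and each of the six conditions says
  that every \<open>p\<close> with \<open>pB\<close> invariant is associated to an element of \<open>A\<close>. Under this condition
  \<open>L\<^sup>*/B\<^sup>*\<close> is free on the primes, \<open>K\<^sup>*\<close> generates the subgroup spanned by the invariant primes and the
  sums \<open>[p] + [bar p]\<close>, and the functions \<open>v\<^sub>p - v\<^sub>(bar p)\<close> on the quotient are coordinates with respect
  to a transversal. Conversely, an invariant \<open>p\<close> that is not associated to a real element gives an
  element \<open>[p]\<close> of order two and, via the real and imaginary parts of \<open>p\<close>, an element of \<open>\<Delta>(B)\<close> in the
  class \<open>[p]\<close> that is not associated to \<open>p\<close>.\<close>

section \<open>Multiplicities in a unique factorization domain\<close>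

text \<open>Since \<open>f * bar f\<close> lies in \<open>A\<close>, conjugation replaces division:
  \<open>f/g\<close> and \<open>f * bar g\<close> have the same polar class, so every question about
  \<Pi>(A) can be settled by divisibility inside \<open>B\<close>. The obstacle is an asymmetry.
  Membership in \<Delta>(B) forbids only divisors from \<open>A\<close>, whereas coprimality of
  \<open>f\<close> and \<open>bar f\<close> forbids all common divisors. A common prime
  \<open>p\<close> with \<open>pB\<close> not invariant does produce the real divisor
  \<open>p * bar p\<close> of \<open>f\<close>. For \<open>pB\<close> invariant, however,
  \<open>p * bar p\<close> is \<open>p^2\<close> up to a unit, which is too much if \<open>p\<close>
  divides \<open>f\<close> only once, and then a real divisor is available only if \<open>p\<close>
  itself is real up to a unit. This is the single place where the passage from common divisors to
  real divisors can fail, and it explains why a condition on invariant primes governs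
  everything.\<close>

locale unique_factorization_domain = domain R + mult: factorial_monoid "mult_of R"
  for R (structure)
begin

text \<open>Induction on a list of irreducible factors. The rule speaks of products
  \<open>p \<otimes> b\<close> instead of lists, so that statements on divisibility, multiplicities
  and polar classes can be proved one irreducible factor at a time.\<close>

lemma nonzero_induct [consumes 1, case_names unit irreducible]:
  assumes "a \<in> carrier R - {\<zero>}"
    and unit: "\<And>u. u \<in> Units R \<Longrightarrow> P u"
    and irr: "\<And>p b. \<lbrakk>p \<in> carrier R; ring_irreducible p; b \<in> carrier R - {\<zero>}; P b\<rbrakk> \<Longrightarrow> P (p \<otimes> b)"
  shows "P a"
proof -
  have "P a" if "a \<in> carrier R - {\<zero>}" "set as \<subseteq> carrier R - {\<zero>}"
    "wfactors (mult_of R) as a" for as a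
    using that
  proof (induction as arbitrary: a)
    case Nil
    then have "\<one> \<sim>\<^bsub>mult_of R\<^esub> a"
      by (simp add: wfactors_def)
    then have "\<one> \<sim> a"
      using Nil.prems(1) assoc_iff_assoc_mult[of \<one> a] by blast
    then have "a divides \<one>"
      by (simp add: associated_def)
    then have "a \<in> Units R"
      using Nil.prems(1) divides_one[of a] by blast
    then show ?case by (rule unit)
  next
    case (Cons p as)
    define c where "c = foldr (\<otimes>) as \<one>"
    have c: "c \<in> carrier R - {\<zero>}"
      unfolding c_def using Cons.prems(2) mult_of.multlist_closed[of as] by simp
    have p: "p \<in> carrier R - {\<zero>}" "irreducible (mult_of R) p"
      using Cons.prems by (auto simp: wfactors_def)
    have "p \<otimes> c \<sim>\<^bsub>mult_of R\<^esub> a"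
      using Cons.prems(3) by (simp add: wfactors_def c_def)
    then have "p \<otimes> c \<sim> a"
      using Cons.prems(1) p c assoc_iff_assoc_mult[of "p \<otimes> c" a] by blast
    then have "a \<sim> p \<otimes> c"
      by (rule associated_sym)
    then obtain u where u: "u \<in> Units R" "a = u \<otimes> (p \<otimes> c)"
      using Cons.prems(1) p c ring_associated_iff[of a "p \<otimes> c"] by auto
    \<comment> \<open>\<open>wfactors\<close> determines a product only up to associates, so a stray
      unit \<open>u\<close> remains. It is moved into the cofactor: \<open>u \<otimes> c\<close>
      still has the factor list \<open>as\<close>, and the induction hypothesis applies to
      it.\<close>
    have uc: "u \<otimes> c \<in> carrier R - {\<zero>}"
      using u p c Cons.prems(1) integral_iff by (auto simp: Units_closed)
    have "c \<sim> u \<otimes> c"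
      using c u(1) uc ring_associated_iff[of "u \<otimes> c" c] by (blast intro: associated_sym)
    then have "wfactors (mult_of R) as (u \<otimes> c)"
      using Cons.prems(3) c uc assoc_iff_assoc_mult[of c "u \<otimes> c"]
      by (simp add: wfactors_def c_def)
    moreover have "set as \<subseteq> carrier R - {\<zero>}"
      using Cons.prems(2) by simp
    ultimately have "P (u \<otimes> c)"
      using Cons.IH uc by blast
    then have "P (p \<otimes> (u \<otimes> c))"
      using irr p uc ring_irreducibleI' by blast
    moreover have "p \<otimes> (u \<otimes> c) = a"
      using u p c m_lcomm Units_closed by auto
    ultimately show ?case by simp
  qed
  then show ?thesis
    using mult.wfactors_exist[of a] assms(1) by auto
qed

lemma irreducible_divides_mult:
  assumes "p \<in> carrier R" "ring_irreducible p" "a \<in> carrier R" "b \<in> carrier R"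
    "p divides a \<otimes> b"
  shows "p divides a \<or> p divides b"
proof -
  have "irreducible (mult_of R) p" "p \<noteq> \<zero>"
    using ring_irreducibleE[OF assms(1,2)] by auto
  then have "prime (mult_of R) p"
    using mult.irreducible_prime[of p] assms(1) by simp
  then have "prime R p"
    using prime_eq_prime_mult[OF assms(1)] by blast
  then show ?thesis
    using assms(3-5) by (auto simp: prime_def)
qed

lemma irreducible_divides_irreducible:
  assumes "p \<in> carrier R" "ring_irreducible p" "q \<in> carrier R" "ring_irreducible q"
    "p divides q"
  shows "p \<sim> q"
proof -
  obtain c where c: "c \<in> carrier R" "q = p \<otimes> c"
    using assms(5) by (auto simp: factor_def)
  then have "c \<in> Units R"
    using ring_irreducibleE(4)[OF assms(1,2)] ring_irreducibleE(5)[OF assms(3,4,1)] by blast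
  then show ?thesis
    using c assms(1,3) ring_associated_iff[of q p] m_comm[of p c] associated_sym by blast
qed

lemma associated_irreducible:
  assumes p: "p \<in> carrier R" "ring_irreducible p" and q: "q \<in> carrier R" "q \<sim> p"
  shows "ring_irreducible q"
proof -
  have pq: "p \<sim>\<^bsub>mult_of R\<^esub> q"
    using assoc_iff_assoc_mult[OF p(1) q(1)] associated_sym[OF q(2)] by blast
  have "p divides q"
    using q(2) by (simp add: associated_def)
  moreover have "q divides p"
    using q(2) by (simp add: associated_def)
  ultimately have "q \<noteq> \<zero>"
    using ring_irreducibleE(1)[OF p] zero_divides[of p] by auto
  then have "q \<in> carrier R - {\<zero>}"
    using q(1) by simp
  moreover have "irreducible (mult_of R) q"
    using mult_of.irreducible_cong[OF ring_irreducibleE(3)[OF p] pq] p(1)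
      ring_irreducibleE(1)[OF p] calculation by simp
  ultimately show ?thesis
    by (rule ring_irreducibleI')
qed

lemma irreducible_divisor_exists:
  assumes "a \<in> carrier R - {\<zero>}" "a \<notin> Units R"
  obtains p where "p \<in> carrier R" "ring_irreducible p" "p divides a"
proof -
  have "a \<in> Units R \<or> (\<exists>p. p \<in> carrier R \<and> ring_irreducible p \<and> p divides a)"
    using assms(1)
  proof (induction rule: nonzero_induct)
    case (irreducible p b)
    then have "p divides p \<otimes> b"
      by (auto simp: factor_def)
    with irreducible show ?case
      by blast
  qed blast
  then show thesis
    using assms(2) that by blast
qed

text \<open>Euclid's lemma, by removing the irreducible factors of \<open>b\<close> one by one: such
  a factor \<open>p\<close> divides \<open>f \<otimes> c\<close> but not \<open>f\<close>, hence
  divides \<open>c\<close> and cancels. Coprimality is phrased through irreducibles because this is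
  the form in which it is obtained for \<open>f\<close> and its conjugate.\<close>

lemma coprime_divides_mult:
  assumes "b \<in> carrier R - {\<zero>}" "f \<in> carrier R" "g \<in> carrier R"
    and "f divides b \<otimes> g"
    and "\<And>p. \<lbrakk>p \<in> carrier R; ring_irreducible p; p divides f; p divides b\<rbrakk> \<Longrightarrow> False"
  shows "f divides g"
  using assms(1,4,5)
proof (induction rule: nonzero_induct)
  case (unit u)
  then obtain c where c: "c \<in> carrier R" "u \<otimes> g = f \<otimes> c"
    by (auto simp: factor_def)
  have "g = inv u \<otimes> (u \<otimes> g)"
    using unit(1) assms(3) by (simp add: m_assoc[symmetric] Units_closed)
  also have "\<dots> = f \<otimes> (inv u \<otimes> c)"
    using unit(1) c assms(2) by (simp add: m_lcomm)
  finally show ?case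
    using unit(1) c(1) by (auto simp: factor_def)
next
  case (irreducible p b)
  obtain c where c: "c \<in> carrier R" "p \<otimes> b \<otimes> g = f \<otimes> c"
    using irreducible.prems(1) by (auto simp: factor_def)
  have "p divides f \<otimes> c"
    using c irreducible.hyps assms(3) by (intro dividesI'[where c = "b \<otimes> g"]) (auto simp: m_assoc)
  moreover have "p divides p \<otimes> b"
    using irreducible.hyps by (auto simp: factor_def)
  ultimately have "p divides c"
    using irreducible_divides_mult irreducible.hyps c(1) assms(2) irreducible.prems(2) by blast
  then obtain d where d: "d \<in> carrier R" "c = p \<otimes> d"
    by (auto simp: factor_def)
  have "p \<otimes> (b \<otimes> g) = p \<otimes> (f \<otimes> d)"
    using c d irreducible.hyps assms(2,3) by (simp add: m_assoc m_lcomm)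
  then have "b \<otimes> g = f \<otimes> d"
    using m_lcancel[of p] d irreducible.hyps assms(2,3) ring_irreducibleE(1)[of p] by simp
  then have "f divides b \<otimes> g"
    using d(1) by (auto simp: factor_def)
  moreover have False if "q \<in> carrier R" "ring_irreducible q" "q divides f" "q divides b" for q
  proof -
    have "q divides p \<otimes> b"
      using that(1,4) irreducible.hyps by (meson DiffD1 divides_prod_l)
    then show False
      using irreducible.prems(2) that by blast
  qed
  ultimately show ?case
    using irreducible.IH by blast
qed

section \<open>Multiplicities of irreducible factors\<close>

definition mult_factors :: "'a \<Rightarrow> 'a list" where
  "mult_factors a = (SOME as. set as \<subseteq> carrier (mult_of R) \<and> wfactors (mult_of R) as a)"

text \<open>This is the valuation of \<open>a\<close> at \<open>p\<close>. The factor list is an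
  arbitrary choice, but its multiset of associate classes is not, by unique factorization; counting
  is therefore done on classes.\<close>

definition count_factor :: "'a \<Rightarrow> 'a \<Rightarrow> nat" where
  "count_factor p a = count (fmset (mult_of R) (mult_factors a)) (assocs (mult_of R) p)"

lemma mult_factors:
  assumes "a \<in> carrier R - {\<zero>}"
  shows "set (mult_factors a) \<subseteq> carrier (mult_of R)" "wfactors (mult_of R) (mult_factors a) a"
  using someI_ex[OF mult.wfactors_exist[of a]] assms unfolding mult_factors_def by auto

lemma count_factor_mult:
  assumes "a \<in> carrier R - {\<zero>}" "b \<in> carrier R - {\<zero>}"
  shows "count_factor p (a \<otimes> b) = count_factor p a + count_factor p b"
proof -
  have "a \<otimes> b \<in> carrier R - {\<zero>}"
    using assms integral_iff by auto
  then have "fmset (mult_of R) (mult_factors (a \<otimes> b)) =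
      fmset (mult_of R) (mult_factors a) + fmset (mult_of R) (mult_factors b)"
    using mult.mult_wfactors_fmset[of "mult_factors a" a "mult_factors b" b "mult_factors (a \<otimes> b)"]
      mult_factors assms by simp
  then show ?thesis
    by (simp add: count_factor_def)
qed

text \<open>Forced by additivity: the value at \<open>\<one>\<close> equals its own double, and the
  values at \<open>u\<close> and \<open>inv u\<close> are natural numbers with sum zero.\<close>

lemma count_factor_unit:
  assumes "u \<in> Units R"
  shows "count_factor p u = 0"
proof -
  have nz: "\<one> \<in> carrier R - {\<zero>}" by simp
  have "count_factor p \<one> = 0"
    using count_factor_mult[OF nz nz, of p] by simp
  moreover have "u \<in> carrier R - {\<zero>}" "inv u \<in> carrier R - {\<zero>}"
    using assms Units_mult_eq_Units mult_of.Units_closed mult_of.Units_inv_closed[of u]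
    by (auto dest: mult_of.Units_closed)
  ultimately show ?thesis
    using count_factor_mult[of u "inv u" p] assms by simp
qed

text \<open>The list \<open>[q]\<close> is a factorization of \<open>q\<close>, so uniqueness
  identifies its multiset of classes with that of the chosen factorization.\<close>

lemma count_factor_irreducible:
  assumes "p \<in> carrier R - {\<zero>}" "q \<in> carrier R" "ring_irreducible q"
  shows "count_factor p q = (if p \<sim> q then 1 else 0)"
proof -
  have q: "q \<in> carrier (mult_of R)" "irreducible (mult_of R) q" "q \<noteq> \<zero>"
    using assms ring_irreducibleE by auto
  have "wfactors (mult_of R) [q] q"
    unfolding wfactors_def using q by auto
  then have "fmset (mult_of R) (mult_factors q) = fmset (mult_of R) [q]"
    using mult_of.ee_fmset[OF mult.wfactors_unique[of "mult_factors q" q "[q]"]]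
      mult_factors[of q] q by simp
  then have "count_factor p q = (if assocs (mult_of R) q = assocs (mult_of R) p then 1 else 0)"
    by (simp add: count_factor_def fmset_def)
  also have "assocs (mult_of R) q = assocs (mult_of R) p \<longleftrightarrow> q \<sim>\<^bsub>mult_of R\<^esub> p"
  proof
    assume "assocs (mult_of R) q = assocs (mult_of R) p"
    then show "q \<sim>\<^bsub>mult_of R\<^esub> p"
      using mult_of.assocs_eqD[of p q] mult_of.associated_sym assms q by simp
  next
    assume qp: "q \<sim>\<^bsub>mult_of R\<^esub> p"
    have "p \<in> carrier (mult_of R)"
      using assms by simp
    with qp have "p \<in> assocs (mult_of R) q"
      using mult_of.associated_sym[OF qp] by (auto simp: eq_closure_of_def elem_def)
    then show "assocs (mult_of R) q = assocs (mult_of R) p"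
      using mult_of.assocs_repr_independence[of p q] q by simp
  qed
  also have "\<dots> \<longleftrightarrow> p \<sim> q"
    using assms q assoc_iff_assoc_mult[of q p] by (blast intro: associated_sym)
  finally show ?thesis .
qed

end


section \<open>Fractions\<close>

context domain
begin

text \<open>Two classes agree when their representatives are related, once \<open>frac_rel\<close>
  is symmetric and transitive. Transitivity is where the absence of zero divisors enters, in
  cancelling the middle denominator \<open>d\<close>.\<close>

lemma fraction_eq_iff:
  assumes "a \<in> carrier R" "b \<in> nonzero R" "c \<in> carrier R" "d \<in> nonzero R"
  shows "fraction R a b = fraction R c d \<longleftrightarrow> a \<otimes> d = c \<otimes> b"
proof -
  have sym: "sym (frac_rel R)"
    by (auto simp: sym_def frac_rel_def)
  have trans: "trans (frac_rel R)"
  proof (rule transI)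
    fix x y z
    assume "(x, y) \<in> frac_rel R" "(y, z) \<in> frac_rel R"
    then obtain a b c d e f where xyz: "x = (a, b)" "y = (c, d)" "z = (e, f)"
      and car: "a \<in> carrier R" "b \<in> carrier R" "c \<in> carrier R" "d \<in> carrier R"
        "e \<in> carrier R" "f \<in> carrier R"
      and nz: "b \<noteq> \<zero>" "d \<noteq> \<zero>" "f \<noteq> \<zero>"
      and eq: "a \<otimes> d = c \<otimes> b" "c \<otimes> f = e \<otimes> d"
      by (auto simp: frac_rel_def nonzero_def)
    have "d \<otimes> (a \<otimes> f) = (a \<otimes> d) \<otimes> f"
      using car by (simp add: m_ac)
    also have "\<dots> = b \<otimes> (c \<otimes> f)"
      using car by (simp add: eq(1) m_ac)
    also have "\<dots> = d \<otimes> (e \<otimes> b)"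
      using car by (simp add: eq(2) m_ac)
    finally have "a \<otimes> f = e \<otimes> b"
      using car nz m_lcancel by simp
    then show "(x, z) \<in> frac_rel R"
      using xyz car nz by (simp add: frac_rel_def nonzero_def)
  qed
  have refl: "((a, b), (a, b)) \<in> frac_rel R" "((c, d), (c, d)) \<in> frac_rel R"
    using assms by (auto simp: frac_rel_def)
  have "fraction R a b = fraction R c d \<longleftrightarrow> ((a, b), (c, d)) \<in> frac_rel R"
    unfolding fraction_def
    using refl symD[OF sym] transD[OF trans] by blast
  then show ?thesis
    using assms by (auto simp: frac_rel_def)
qed

text \<open>All pairs of representatives give the same product class, and a union of copies of one
  set over nonempty index sets is that set.\<close>

lemma fraction_mult:
  assumes "a \<in> carrier R" "b \<in> nonzero R" "c \<in> carrier R" "d \<in> nonzero R"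
  shows "fraction R a b \<otimes>\<^bsub>fraction_field R\<^esub> fraction R c d = fraction R (a \<otimes> c) (b \<otimes> d)"
proof -
  have eq: "fraction R (a' \<otimes> c') (b' \<otimes> d') = fraction R (a \<otimes> c) (b \<otimes> d)"
    if "(a', b') \<in> fraction R a b" "(c', d') \<in> fraction R c d" for a' b' c' d'
  proof -
    have car: "a' \<in> carrier R" "b' \<in> carrier R" "c' \<in> carrier R" "d' \<in> carrier R"
        "b' \<in> nonzero R" "d' \<in> nonzero R"
      and *: "a \<otimes> b' = a' \<otimes> b" "c \<otimes> d' = c' \<otimes> d"
      using that by (auto simp: fraction_def frac_rel_def nonzero_def)
    have car': "b \<in> carrier R" "d \<in> carrier R"
      using assms by (auto simp: nonzero_def)
    have "(a' \<otimes> c') \<otimes> (b \<otimes> d) = (a' \<otimes> b) \<otimes> (c' \<otimes> d)"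
      using assms car car' by (simp add: m_ac)
    also have "\<dots> = (a \<otimes> c) \<otimes> (b' \<otimes> d')"
      using assms car car' by (simp add: *[symmetric] m_ac)
    finally show ?thesis
      using assms car by (subst fraction_eq_iff) (auto simp: nonzero_def integral_iff)
  qed
  define F where "F x y = fraction R (fst x \<otimes> fst y) (snd x \<otimes> snd y)" for x y
  have F: "F x y = fraction R (a \<otimes> c) (b \<otimes> d)"
    if "x \<in> fraction R a b" "y \<in> fraction R c d" for x y
    using eq[of "fst x" "snd x" "fst y" "snd y"] that by (simp add: F_def)
  have ne: "fraction R a b \<noteq> {}" "fraction R c d \<noteq> {}"
    using assms by (auto simp: fraction_def frac_rel_def)
  have "(\<Union>y\<in>fraction R c d. F x y) = fraction R (a \<otimes> c) (b \<otimes> d)" if "x \<in> fraction R a b" for x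
    by (rule SUP_eq_const[OF ne(2)]) (rule F[OF that])
  then have "(\<Union>x\<in>fraction R a b. \<Union>y\<in>fraction R c d. F x y) = fraction R (a \<otimes> c) (b \<otimes> d)"
    by (rule SUP_eq_const[OF ne(1)])
  then show ?thesis
    by (simp add: fraction_field_def case_prod_unfold F_def)
qed

lemma nonzero_mult_closed [simp]: "a \<in> nonzero R \<Longrightarrow> b \<in> nonzero R \<Longrightarrow> a \<otimes> b \<in> nonzero R"
  by (auto simp: nonzero_def integral_iff)

lemma nonzero_one [simp]: "\<one> \<in> nonzero R"
  by (simp add: nonzero_def)

lemma nonzero_closed: "a \<in> nonzero R \<Longrightarrow> a \<in> carrier R"
  by (simp add: nonzero_def)

lemma Units_nonzero: "u \<in> Units R \<Longrightarrow> u \<in> nonzero R"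
  using mult_of.Units_closed[of u] by (simp add: nonzero_def)

text \<open>The polar group sees only the multiplication of the fraction field, and the units of a
  commutative monoid form a commutative group.\<close>

lemma comm_monoid_fraction_field: "comm_monoid (fraction_field R)"
proof (rule comm_monoidI)
  have carrier: "carrier (fraction_field R) = {fraction R a b |a b. a \<in> carrier R \<and> b \<in> nonzero R}"
    and one: "\<one>\<^bsub>fraction_field R\<^esub> = fraction R \<one> \<one>"
    by (simp_all add: fraction_field_def)
  show "\<one>\<^bsub>fraction_field R\<^esub> \<in> carrier (fraction_field R)"
    unfolding carrier one by fastforce
  fix x assume "x \<in> carrier (fraction_field R)"
  then obtain a b where x: "x = fraction R a b" "a \<in> carrier R" "b \<in> nonzero R"
    unfolding carrier by auto
  show "\<one>\<^bsub>fraction_field R\<^esub> \<otimes>\<^bsub>fraction_field R\<^esub> x = x"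
    using x by (simp add: one fraction_mult nonzero_closed)
  fix y assume "y \<in> carrier (fraction_field R)"
  then obtain c d where y: "y = fraction R c d" "c \<in> carrier R" "d \<in> nonzero R"
    unfolding carrier by auto
  show "x \<otimes>\<^bsub>fraction_field R\<^esub> y \<in> carrier (fraction_field R)"
    unfolding carrier using x y fraction_mult[of a b c d] nonzero_mult_closed m_closed by blast
  show "x \<otimes>\<^bsub>fraction_field R\<^esub> y = y \<otimes>\<^bsub>fraction_field R\<^esub> x"
    using x y by (simp add: fraction_mult nonzero_closed m_comm)
  fix z assume "z \<in> carrier (fraction_field R)"
  then obtain e f where z: "z = fraction R e f" "e \<in> carrier R" "f \<in> nonzero R"
    unfolding carrier by auto
  show "x \<otimes>\<^bsub>fraction_field R\<^esub> y \<otimes>\<^bsub>fraction_field R\<^esub> z =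
      x \<otimes>\<^bsub>fraction_field R\<^esub> (y \<otimes>\<^bsub>fraction_field R\<^esub> z)"
    using x y z by (simp add: fraction_mult nonzero_closed m_assoc)
qed

lemma Units_fraction_field:
  "Units (fraction_field R) = {fraction R a b |a b. a \<in> nonzero R \<and> b \<in> nonzero R}"
proof (intro equalityI subsetI)
  have carrier: "carrier (fraction_field R) = {fraction R a b |a b. a \<in> carrier R \<and> b \<in> nonzero R}"
    and one: "\<one>\<^bsub>fraction_field R\<^esub> = fraction R \<one> \<one>"
    by (simp_all add: fraction_field_def)
  {
    fix x assume "x \<in> Units (fraction_field R)"
    then obtain y where xy: "x \<in> carrier (fraction_field R)" "y \<in> carrier (fraction_field R)"
      "x \<otimes>\<^bsub>fraction_field R\<^esub> y = \<one>\<^bsub>fraction_field R\<^esub>"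
      by (auto simp: Units_def)
    obtain a b where x: "x = fraction R a b" "a \<in> carrier R" "b \<in> nonzero R"
      using xy(1) unfolding carrier by auto
    obtain c d where y: "y = fraction R c d" "c \<in> carrier R" "d \<in> nonzero R"
      using xy(2) unfolding carrier by auto
    have "fraction R (a \<otimes> c) (b \<otimes> d) = fraction R \<one> \<one>"
      using xy(3) x y by (simp add: one fraction_mult)
    then have "a \<otimes> c = b \<otimes> d"
      using x y by (subst (asm) fraction_eq_iff) (auto simp: nonzero_closed)
    then have "a \<in> nonzero R"
      using x y nonzero_mult_closed[of b d] by (auto simp: nonzero_def)
    then show "x \<in> {fraction R a b |a b. a \<in> nonzero R \<and> b \<in> nonzero R}"
      using x by blast
  next
    fix x assume "x \<in> {fraction R a b |a b. a \<in> nonzero R \<and> b \<in> nonzero R}"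
    then obtain a b where x: "x = fraction R a b" "a \<in> nonzero R" "b \<in> nonzero R"
      by blast
    have "fraction R a b \<otimes>\<^bsub>fraction_field R\<^esub> fraction R b a = \<one>\<^bsub>fraction_field R\<^esub>"
      "fraction R b a \<otimes>\<^bsub>fraction_field R\<^esub> fraction R a b = \<one>\<^bsub>fraction_field R\<^esub>"
      using x by (simp_all add: one fraction_mult fraction_eq_iff nonzero_closed m_comm)
    moreover have "fraction R a b \<in> carrier (fraction_field R)"
      "fraction R b a \<in> carrier (fraction_field R)"
      unfolding carrier using x nonzero_closed by blast+
    ultimately show "x \<in> Units (fraction_field R)"
      unfolding Units_def x(1) by blast
  }
qed

end


section \<open>Torsion in free abelian groups\<close>

lemma torsion_free_imp_square_torsion_free: "torsion_free G \<Longrightarrow> square_torsion_free G"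
  unfolding torsion_free_def square_torsion_free_def using zero_less_numeral by blast

text \<open>Under the isomorphism a power becomes an integer multiple of a formal sum, and integer
  coefficients have no torsion.\<close>

lemma free_basis_imp_torsion_free:
  assumes "group G" "is_free_basis G S"
  shows "torsion_free G"
  unfolding torsion_free_def
proof (intro ballI allI impI)
  fix \<gamma> and n :: nat
  assume \<gamma>: "\<gamma> \<in> carrier G" and n: "n > 0 \<and> \<gamma> [^]\<^bsub>G\<^esub> n = \<one>\<^bsub>G\<^esub>"
  obtain h where h: "h \<in> iso (free_Abelian_group S) G"
    using assms(2) by (auto simp: is_free_basis_def)
  interpret h: group_hom "free_Abelian_group S" G h
    using h assms(1) by (simp add: group_hom_def group_hom_axioms_def iso_def)
  have inj: "inj_on h (carrier (free_Abelian_group S))"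
    and surj: "h ` carrier (free_Abelian_group S) = carrier G"
    using h by (auto simp: iso_def bij_betw_def)
  obtain x where x: "x \<in> carrier (free_Abelian_group S)" "\<gamma> = h x"
    using \<gamma> surj by blast
  have "h (x [^]\<^bsub>free_Abelian_group S\<^esub> n) = \<one>\<^bsub>G\<^esub>"
    using n x h.hom_nat_pow by simp
  then have "x [^]\<^bsub>free_Abelian_group S\<^esub> n = \<one>\<^bsub>free_Abelian_group S\<^esub>"
    using inj h.inj_on_one_iff x(1) h.G.nat_pow_closed by blast
  then have "frag_cmul (int n) x = 0"
    by simp
  then have "x = 0"
    using n by simp
  then show "\<gamma> = \<one>\<^bsub>G\<^esub>"
    using x(2) h.hom_one by simp
qed


section \<open>Conjugation on \<open>A[i]\<close>\<close>

text \<open>The real scalars enter through \<open>two_unit\<close>. It yields the final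
  contradiction for an irreducible \<open>p\<close> dividing both \<open>1 + u\<close> and
  \<open>1 - u\<close>, and therefore 2.\<close>

locale complexified_ufd = A: domain A + B: unique_factorization_domain "complexify A"
  for A :: "('a, 'm) ring_scheme" (structure) +
  assumes two_unit: "\<one> \<oplus> \<one> \<in> Units A"
begin

abbreviation B :: "('a \<times> 'a) ring" where
  "B \<equiv> complexify A"

abbreviation bar :: "'a \<times> 'a \<Rightarrow> 'a \<times> 'a" where
  "bar \<equiv> conjugate A"

abbreviation emb :: "'a \<Rightarrow> 'a \<times> 'a" where
  "emb \<equiv> embed A"

lemma carrier_B: "carrier B = carrier A \<times> carrier A"
  and mult_B: "(a, b) \<otimes>\<^bsub>B\<^esub> (c, d) = ((a \<otimes> c) \<ominus> (b \<otimes> d), (a \<otimes> d) \<oplus> (b \<otimes> c))"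
  and add_B: "(a, b) \<oplus>\<^bsub>B\<^esub> (c, d) = (a \<oplus> c, b \<oplus> d)"
  and one_B: "\<one>\<^bsub>B\<^esub> = (\<one>, \<zero>)"
  and zero_B: "\<zero>\<^bsub>B\<^esub> = (\<zero>, \<zero>)"
  by (simp_all add: complexify_def)

lemma bar_closed [simp]: "f \<in> carrier B \<Longrightarrow> bar f \<in> carrier B"
  by (auto simp: carrier_B conjugate_def)

lemma bar_bar [simp]: "f \<in> carrier B \<Longrightarrow> bar (bar f) = f"
  by (auto simp: carrier_B conjugate_def)

lemma bar_mult:
  assumes "f \<in> carrier B" "g \<in> carrier B"
  shows "bar (f \<otimes>\<^bsub>B\<^esub> g) = bar f \<otimes>\<^bsub>B\<^esub> bar g"
proof -
  obtain a b c d where "f = (a, b)" "g = (c, d)"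
    "a \<in> carrier A" "b \<in> carrier A" "c \<in> carrier A" "d \<in> carrier A"
    using assms by (auto simp: carrier_B)
  then show ?thesis
    by (simp add: conjugate_def mult_B A.l_minus A.r_minus A.minus_add A.a_ac A.minus_eq)
qed

lemma bar_emb [simp]: "bar (emb a) = emb a"
  by (simp add: conjugate_def embed_def)

lemma emb_one: "emb \<one> = \<one>\<^bsub>B\<^esub>"
  by (simp add: embed_def one_B)

lemma bar_one [simp]: "bar \<one>\<^bsub>B\<^esub> = \<one>\<^bsub>B\<^esub>"
  using bar_emb[of \<one>] by (simp add: emb_one)

lemma emb_closed [simp]: "a \<in> carrier A \<Longrightarrow> emb a \<in> carrier B"
  by (simp add: embed_def carrier_B)

lemma emb_nonzero [simp]: "a \<in> nonzero A \<Longrightarrow> emb a \<in> nonzero B"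
  by (simp add: embed_def nonzero_def carrier_B zero_B)

lemma emb_mult: "a \<in> carrier A \<Longrightarrow> b \<in> carrier A \<Longrightarrow> emb (a \<otimes> b) = emb a \<otimes>\<^bsub>B\<^esub> emb b"
  by (simp add: embed_def mult_B A.minus_eq)

lemma emb_mult_pair:
  "a \<in> carrier A \<Longrightarrow> b \<in> carrier A \<Longrightarrow> c \<in> carrier A \<Longrightarrow> emb a \<otimes>\<^bsub>B\<^esub> (b, c) = (a \<otimes> b, a \<otimes> c)"
  by (simp add: embed_def mult_B A.minus_eq)

lemma bar_nonzero [simp]:
  assumes "f \<in> nonzero B"
  shows "bar f \<in> nonzero B"
  using assms by (auto simp: nonzero_def carrier_B zero_B conjugate_def A.add.inv_eq_1_iff)

lemma bar_unit [simp]: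
  assumes "u \<in> Units B"
  shows "bar u \<in> Units B"
proof -
  have "bar (inv\<^bsub>B\<^esub> u) \<otimes>\<^bsub>B\<^esub> bar u = \<one>\<^bsub>B\<^esub>"
    using assms bar_mult[of "inv\<^bsub>B\<^esub> u" u] by (simp add: B.Units_closed)
  moreover have "bar u \<otimes>\<^bsub>B\<^esub> bar (inv\<^bsub>B\<^esub> u) = \<one>\<^bsub>B\<^esub>"
    using assms bar_mult[of u "inv\<^bsub>B\<^esub> u"] by (simp add: B.Units_closed)
  moreover have "bar u \<in> carrier B" "bar (inv\<^bsub>B\<^esub> u) \<in> carrier B"
    using assms by (simp_all add: B.Units_closed)
  ultimately show ?thesis
    unfolding Units_def[of B] by blast
qed

text \<open>Multiplication by a real element acts separately on the two coordinates, so the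
  imaginary part of \<open>g\<close> must vanish. In terms of fractions this is
  \<open>K \<inter> B = A\<close>.\<close>

lemma emb_cofactor:
  assumes "b \<in> nonzero A" "g \<in> carrier B" "emb b \<otimes>\<^bsub>B\<^esub> g = emb a"
  obtains c where "c \<in> carrier A" "g = emb c" "b \<otimes> c = a"
proof -
  obtain c d where g: "g = (c, d)" "c \<in> carrier A" "d \<in> carrier A"
    using assms(2) by (auto simp: carrier_B)
  have b: "b \<in> carrier A" "b \<noteq> \<zero>"
    using assms(1) by (auto simp: nonzero_def)
  have "(b \<otimes> c, b \<otimes> d) = (a, \<zero>)"
    using assms(3) g b emb_mult_pair[of b c d] by (simp add: embed_def)
  then have "b \<otimes> c = a" "d = \<zero>"
    using A.integral_iff[of b d] b g by auto
  then show thesis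
    using that[of c] g by (simp add: embed_def)
qed

lemma emb_unit_iff:
  assumes "a \<in> carrier A"
  shows "emb a \<in> Units B \<longleftrightarrow> a \<in> Units A"
proof
  assume a: "emb a \<in> Units B"
  have nz: "a \<in> nonzero A"
    using B.Units_nonzero[OF a] assms by (auto simp: nonzero_def embed_def zero_B)
  have "emb a \<otimes>\<^bsub>B\<^esub> inv\<^bsub>B\<^esub> (emb a) = emb \<one>"
    using a by (simp add: emb_one)
  then obtain c where "c \<in> carrier A" "a \<otimes> c = \<one>"
    using emb_cofactor[OF nz] B.Units_inv_closed[OF a] by blast
  then show "a \<in> Units A"
    using assms A.m_comm[of a c] unfolding Units_def by auto
next
  assume a: "a \<in> Units A"
  have "emb a \<otimes>\<^bsub>B\<^esub> emb (inv a) = \<one>\<^bsub>B\<^esub>" "emb (inv a) \<otimes>\<^bsub>B\<^esub> emb a = \<one>\<^bsub>B\<^esub>"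
    using a emb_mult[of a "inv a"] emb_mult[of "inv a" a] assms by (simp_all add: emb_one)
  moreover have "emb a \<in> carrier B" "emb (inv a) \<in> carrier B"
    using assms a by simp_all
  ultimately show "emb a \<in> Units B"
    unfolding Units_def[of B] by blast
qed

section \<open>Norms, real parts and imaginary parts\<close>

lemma norm_real:
  assumes "f \<in> carrier B"
  obtains n where "n \<in> carrier A" "f \<otimes>\<^bsub>B\<^esub> bar f = emb n"
proof -
  obtain a b where f: "f = (a, b)" "a \<in> carrier A" "b \<in> carrier A"
    using assms by (auto simp: carrier_B)
  then have "f \<otimes>\<^bsub>B\<^esub> bar f = emb ((a \<otimes> a) \<oplus> (b \<otimes> b))"
    by (simp add: conjugate_def embed_def mult_B A.r_minus A.minus_eq A.m_comm A.r_neg A.l_neg)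
  then show thesis
    using that[of "(a \<otimes> a) \<oplus> (b \<otimes> b)"] f(2,3) by (simp add: f(1))
qed

text \<open>Makes \<open>bar f\<close> an inverse of \<open>f\<close> up to a factor from
  \<open>A\<close>, which is how denominators are cleared below.\<close>

lemma norm_nonzero:
  assumes "f \<in> nonzero B"
  obtains n where "n \<in> nonzero A" "f \<otimes>\<^bsub>B\<^esub> bar f = emb n"
proof -
  obtain n where n: "n \<in> carrier A" "f \<otimes>\<^bsub>B\<^esub> bar f = emb n"
    using norm_real B.nonzero_closed[OF assms] by blast
  moreover have "f \<otimes>\<^bsub>B\<^esub> bar f \<in> nonzero B"
    using assms by simp
  ultimately have "n \<in> nonzero A"
    by (auto simp: nonzero_def embed_def zero_B)
  then show thesis
    using that n by blast
qed

lemma add_conj: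
  assumes "f \<in> carrier B"
  shows "f \<oplus>\<^bsub>B\<^esub> bar f = emb (fst f \<oplus> fst f)"
  using assms by (auto simp: carrier_B conjugate_def embed_def add_B A.r_neg)

lemma minus_B:
  assumes "f \<in> carrier B"
  shows "\<ominus>\<^bsub>B\<^esub> f = (\<ominus> fst f, \<ominus> snd f)"
proof (rule B.minus_equality)
  show "(\<ominus> fst f, \<ominus> snd f) \<oplus>\<^bsub>B\<^esub> f = \<zero>\<^bsub>B\<^esub>"
    using assms by (auto simp: carrier_B add_B zero_B A.l_neg)
  show "f \<in> carrier B" "(\<ominus> fst f, \<ominus> snd f) \<in> carrier B"
    using assms by (auto simp: carrier_B)
qed

abbreviation imag :: "'a \<times> 'a" where
  "imag \<equiv> (\<zero>, \<one>)"

lemma i_unit: "imag \<in> Units B"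
proof -
  have "imag \<otimes>\<^bsub>B\<^esub> (\<zero>, \<ominus> \<one>) = \<one>\<^bsub>B\<^esub>" "(\<zero>, \<ominus> \<one>) \<otimes>\<^bsub>B\<^esub> imag = \<one>\<^bsub>B\<^esub>"
    by (simp_all add: mult_B one_B A.minus_eq A.r_minus A.l_minus)
  moreover have "imag \<in> carrier B" "(\<zero>, \<ominus> \<one>) \<in> carrier B"
    by (simp_all add: carrier_B)
  ultimately show ?thesis
    unfolding Units_def[of B] by blast
qed

text \<open>The difference is real only up to the unit \<open>imag\<close>. That suffices for its
  later use, because polar classes ignore units.\<close>

lemma diff_conj:
  assumes "f \<in> carrier B"
  shows "f \<ominus>\<^bsub>B\<^esub> bar f = imag \<otimes>\<^bsub>B\<^esub> emb (snd f \<oplus> snd f)"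
proof -
  obtain a b where f: "f = (a, b)" "a \<in> carrier A" "b \<in> carrier A"
    using assms by (auto simp: carrier_B)
  have "f \<ominus>\<^bsub>B\<^esub> bar f = f \<oplus>\<^bsub>B\<^esub> (\<ominus>\<^bsub>B\<^esub> bar f)"
    by (simp add: B.minus_eq)
  also have "\<dots> = (a, b) \<oplus>\<^bsub>B\<^esub> (\<ominus> a, b)"
    using assms f by (simp add: minus_B) (simp add: conjugate_def)
  also have "\<dots> = imag \<otimes>\<^bsub>B\<^esub> emb (b \<oplus> b)"
    using f by (simp add: embed_def mult_B add_B A.minus_eq A.r_neg)
  finally show ?thesis
    using f by simp
qed

lemma bar_divides:
  assumes "f \<in> carrier B" "f divides\<^bsub>B\<^esub> g"
  shows "bar f divides\<^bsub>B\<^esub> bar g"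
proof -
  obtain c where "c \<in> carrier B" "g = f \<otimes>\<^bsub>B\<^esub> c"
    using assms(2) by (auto simp: factor_def)
  then have "bar c \<in> carrier B" "bar g = bar f \<otimes>\<^bsub>B\<^esub> bar c"
    using assms(1) by (simp_all add: bar_mult)
  then show ?thesis
    by (auto simp: factor_def)
qed

lemma bar_associated:
  assumes "f \<in> carrier B" "g \<in> carrier B"
  shows "bar f \<sim>\<^bsub>B\<^esub> bar g \<longleftrightarrow> f \<sim>\<^bsub>B\<^esub> g"
  using assms bar_divides[of f g] bar_divides[of g f]
    bar_divides[of "bar f" "bar g"] bar_divides[of "bar g" "bar f"]
  by (auto simp: associated_def)

lemma bar_irreducible:
  assumes "p \<in> carrier B" "ring_irreducible\<^bsub>B\<^esub> p"
  shows "ring_irreducible\<^bsub>B\<^esub> (bar p)"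
proof (rule B.ring_irreducibleI)
  have p: "p \<in> nonzero B"
    using B.ring_irreducibleE(1)[OF assms] assms(1) by (simp add: nonzero_def)
  show "bar p \<in> carrier B - {\<zero>\<^bsub>B\<^esub>}"
    using bar_nonzero[OF p] by (simp add: nonzero_def)
  show "bar p \<notin> Units B"
    using bar_unit[of "bar p"] B.ring_irreducibleE(4)[OF assms] assms(1) by auto
  fix a b assume ab: "a \<in> carrier B" "b \<in> carrier B" "bar p = a \<otimes>\<^bsub>B\<^esub> b"
  have "p = bar a \<otimes>\<^bsub>B\<^esub> bar b"
    using ab assms(1) by (metis bar_bar bar_mult)
  then have "bar a \<in> Units B \<or> bar b \<in> Units B"
    using B.ring_irreducibleE(5)[OF assms bar_closed[OF ab(1)] bar_closed[OF ab(2)]] by blast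
  then show "a \<in> Units B \<or> b \<in> Units B"
    using ab bar_unit[of "bar a"] bar_unit[of "bar b"] by auto
qed


subsection \<open>The polar group\<close>

lemma comm_group_L: "comm_group (L_units A)"
proof -
  interpret F: comm_monoid "fraction_field B"
    by (rule B.comm_monoid_fraction_field)
  show ?thesis
    unfolding L_units_def by (rule F.units_comm_group)
qed

sublocale L: comm_group "L_units A"
  by (rule comm_group_L)

lemma carrier_L: "carrier (L_units A) = {fraction B f g |f g. f \<in> nonzero B \<and> g \<in> nonzero B}"
  by (simp add: L_units_def units_of_carrier B.Units_fraction_field)

lemma fraction_in_L [simp]: "f \<in> nonzero B \<Longrightarrow> g \<in> nonzero B \<Longrightarrow> fraction B f g \<in> carrier (L_units A)"
  unfolding carrier_L by blast

lemma one_L: "\<one>\<^bsub>L_units A\<^esub> = fraction B \<one>\<^bsub>B\<^esub> \<one>\<^bsub>B\<^esub>"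
  by (simp add: L_units_def units_of_one fraction_field_def)

lemma mult_L:
  assumes "f \<in> nonzero B" "g \<in> nonzero B" "f' \<in> nonzero B" "g' \<in> nonzero B"
  shows "fraction B f g \<otimes>\<^bsub>L_units A\<^esub> fraction B f' g' = fraction B (f \<otimes>\<^bsub>B\<^esub> f') (g \<otimes>\<^bsub>B\<^esub> g')"
  using assms by (simp add: L_units_def units_of_mult B.fraction_mult B.nonzero_closed)

lemma inv_L:
  assumes "f \<in> nonzero B" "g \<in> nonzero B"
  shows "inv\<^bsub>L_units A\<^esub> (fraction B f g) = fraction B g f"
  using assms by (intro L.inv_equality)
    (simp_all add: mult_L one_L B.fraction_eq_iff B.nonzero_closed B.m_comm)

lemma subgroup_B_units: "subgroup (B_units_in_L A) (L_units A)"
proof (rule L.subgroupI)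
  show "B_units_in_L A \<subseteq> carrier (L_units A)"
    by (auto simp: B_units_in_L_def B.Units_nonzero)
  show "B_units_in_L A \<noteq> {}"
    using B.Units_one_closed unfolding B_units_in_L_def by blast
  fix x assume "x \<in> B_units_in_L A"
  then obtain u where u: "u \<in> Units B" "x = fraction B u \<one>\<^bsub>B\<^esub>"
    by (auto simp: B_units_in_L_def)
  have "inv\<^bsub>L_units A\<^esub> x = fraction B \<one>\<^bsub>B\<^esub> u"
    using u by (simp add: inv_L B.Units_nonzero)
  also have "\<dots> = fraction B (inv\<^bsub>B\<^esub> u) \<one>\<^bsub>B\<^esub>"
    using u by (simp add: B.fraction_eq_iff B.Units_nonzero)
  finally show "inv\<^bsub>L_units A\<^esub> x \<in> B_units_in_L A"
    using u B.Units_inv_Units unfolding B_units_in_L_def by blast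
  fix y assume "y \<in> B_units_in_L A"
  then obtain v where v: "v \<in> Units B" "y = fraction B v \<one>\<^bsub>B\<^esub>"
    by (auto simp: B_units_in_L_def)
  have "x \<otimes>\<^bsub>L_units A\<^esub> y = fraction B (u \<otimes>\<^bsub>B\<^esub> v) \<one>\<^bsub>B\<^esub>"
    using u v by (simp add: mult_L B.Units_nonzero)
  then show "x \<otimes>\<^bsub>L_units A\<^esub> y \<in> B_units_in_L A"
    using u v unfolding B_units_in_L_def by blast
qed

lemma subgroup_K_units: "subgroup (K_units_in_L A) (L_units A)"
proof (rule L.subgroupI)
  show "K_units_in_L A \<subseteq> carrier (L_units A)"
    by (auto simp: K_units_in_L_def)
  show "K_units_in_L A \<noteq> {}"
    using A.nonzero_one unfolding K_units_in_L_def by blast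
  fix x assume "x \<in> K_units_in_L A"
  then obtain a b where ab: "a \<in> nonzero A" "b \<in> nonzero A" "x = fraction B (emb a) (emb b)"
    by (auto simp: K_units_in_L_def)
  then show "inv\<^bsub>L_units A\<^esub> x \<in> K_units_in_L A"
    by (auto simp: K_units_in_L_def inv_L)
  fix y assume "y \<in> K_units_in_L A"
  then obtain c d where cd: "c \<in> nonzero A" "d \<in> nonzero A" "y = fraction B (emb c) (emb d)"
    by (auto simp: K_units_in_L_def)
  have "x \<otimes>\<^bsub>L_units A\<^esub> y = fraction B (emb (a \<otimes> c)) (emb (b \<otimes> d))"
    using ab cd by (simp add: mult_L emb_mult A.nonzero_closed)
  then show "x \<otimes>\<^bsub>L_units A\<^esub> y \<in> K_units_in_L A"
    using ab cd A.nonzero_mult_closed unfolding K_units_in_L_def by blast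
qed

lemma subgroup_polar_kernel: "subgroup (polar_kernel A) (L_units A)"
  unfolding polar_kernel_def by (rule L.mult_subgroups[OF subgroup_B_units subgroup_K_units])

lemma polar_kernel_eq:
  "polar_kernel A = {fraction B (u \<otimes>\<^bsub>B\<^esub> emb a) (emb b) |u a b.
     u \<in> Units B \<and> a \<in> nonzero A \<and> b \<in> nonzero A}"
proof -
  have *: "fraction B u \<one>\<^bsub>B\<^esub> \<otimes>\<^bsub>L_units A\<^esub> fraction B (emb a) (emb b) =
      fraction B (u \<otimes>\<^bsub>B\<^esub> emb a) (emb b)"
    if "u \<in> Units B" "a \<in> nonzero A" "b \<in> nonzero A" for u a b
    using that by (simp add: mult_L B.Units_nonzero B.nonzero_closed)
  show ?thesis
  proof (intro equalityI subsetI)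
    fix x assume "x \<in> polar_kernel A"
    then obtain u a b where uab: "u \<in> Units B" "a \<in> nonzero A" "b \<in> nonzero A"
      and x: "x = fraction B u \<one>\<^bsub>B\<^esub> \<otimes>\<^bsub>L_units A\<^esub> fraction B (emb a) (emb b)"
      unfolding polar_kernel_def set_mult_def B_units_in_L_def K_units_in_L_def by blast
    show "x \<in> {fraction B (u \<otimes>\<^bsub>B\<^esub> emb a) (emb b) |u a b.
        u \<in> Units B \<and> a \<in> nonzero A \<and> b \<in> nonzero A}"
      unfolding x *[OF uab] using uab by blast
  next
    fix x assume "x \<in> {fraction B (u \<otimes>\<^bsub>B\<^esub> emb a) (emb b) |u a b.
        u \<in> Units B \<and> a \<in> nonzero A \<and> b \<in> nonzero A}"
    then obtain u a b where uab: "u \<in> Units B" "a \<in> nonzero A" "b \<in> nonzero A"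
      and x: "x = fraction B (u \<otimes>\<^bsub>B\<^esub> emb a) (emb b)"
      by blast
    show "x \<in> polar_kernel A"
      unfolding x *[OF uab, symmetric]
      unfolding polar_kernel_def set_mult_def B_units_in_L_def K_units_in_L_def
      using uab by blast
  qed
qed

text \<open>Expanding by \<open>bar g\<close> writes \<open>f/g\<close> as \<open>f * bar g\<close>
  over the norm of \<open>g\<close>, which belongs to \<open>K\<close>. The converse of this
  computation has to bring a factor from \<open>K\<close> back to \<open>A\<close>.\<close>

lemma fraction_in_polar_kernel_iff:
  assumes f: "f \<in> nonzero B" and g: "g \<in> nonzero B"
  shows "fraction B f g \<in> polar_kernel A \<longleftrightarrow>
    (\<exists>u\<in>Units B. \<exists>a\<in>nonzero A. f \<otimes>\<^bsub>B\<^esub> bar g = u \<otimes>\<^bsub>B\<^esub> emb a)"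
proof -
  obtain n where n: "n \<in> nonzero A" "g \<otimes>\<^bsub>B\<^esub> bar g = emb n"
    using norm_nonzero[OF g] by blast
  have car: "f \<in> carrier B" "g \<in> carrier B" "bar g \<in> carrier B" "n \<in> carrier A"
    using f g n B.nonzero_closed A.nonzero_closed by auto
  show ?thesis
  proof
    assume "fraction B f g \<in> polar_kernel A"
    then obtain u a b where uab: "u \<in> Units B" "a \<in> nonzero A" "b \<in> nonzero A"
      and eq: "fraction B f g = fraction B (u \<otimes>\<^bsub>B\<^esub> emb a) (emb b)"
      unfolding polar_kernel_eq by blast
    have car': "u \<in> carrier B" "inv\<^bsub>B\<^esub> u \<in> carrier B" "emb a \<in> carrier B" "emb b \<in> carrier B"
      "a \<in> carrier A" "b \<in> carrier A"
      using uab A.nonzero_closed by auto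
    have "f \<otimes>\<^bsub>B\<^esub> emb b = u \<otimes>\<^bsub>B\<^esub> emb a \<otimes>\<^bsub>B\<^esub> g"
      using eq f g uab car car' by (simp add: B.fraction_eq_iff)
    then have "emb b \<otimes>\<^bsub>B\<^esub> f = u \<otimes>\<^bsub>B\<^esub> (emb a \<otimes>\<^bsub>B\<^esub> g)"
      using car car' by (simp add: B.m_ac)
    then have "inv\<^bsub>B\<^esub> u \<otimes>\<^bsub>B\<^esub> (emb b \<otimes>\<^bsub>B\<^esub> f) \<otimes>\<^bsub>B\<^esub> bar g = emb a \<otimes>\<^bsub>B\<^esub> (g \<otimes>\<^bsub>B\<^esub> bar g)"
      using uab car car' by (simp add: B.m_assoc[symmetric])
    moreover have "emb b \<otimes>\<^bsub>B\<^esub> (inv\<^bsub>B\<^esub> u \<otimes>\<^bsub>B\<^esub> (f \<otimes>\<^bsub>B\<^esub> bar g)) =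
        inv\<^bsub>B\<^esub> u \<otimes>\<^bsub>B\<^esub> (emb b \<otimes>\<^bsub>B\<^esub> f) \<otimes>\<^bsub>B\<^esub> bar g"
      using car car' by (simp add: B.m_ac)
    ultimately have eq': "emb b \<otimes>\<^bsub>B\<^esub> (inv\<^bsub>B\<^esub> u \<otimes>\<^bsub>B\<^esub> (f \<otimes>\<^bsub>B\<^esub> bar g)) = emb (a \<otimes> n)"
      using n(2) car car' by (simp add: emb_mult)
    \<comment> \<open>The fraction \<open>a * n / b\<close> lies a priori only in \<open>K\<close>.
      As it equals an element of \<open>B\<close>, it lies in \<open>A\<close>.\<close>
    obtain c where c: "c \<in> carrier A" "inv\<^bsub>B\<^esub> u \<otimes>\<^bsub>B\<^esub> (f \<otimes>\<^bsub>B\<^esub> bar g) = emb c" "b \<otimes> c = a \<otimes> n"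
      using emb_cofactor[OF uab(3) _ eq'] car car' by blast
    have "c \<in> nonzero A"
      using c n uab A.nonzero_mult_closed[of a n] car' by (auto simp: nonzero_def)
    moreover have "f \<otimes>\<^bsub>B\<^esub> bar g = u \<otimes>\<^bsub>B\<^esub> emb c"
      using uab car car' by (simp add: c(2)[symmetric] B.m_assoc[symmetric])
    ultimately show "\<exists>u\<in>Units B. \<exists>a\<in>nonzero A. f \<otimes>\<^bsub>B\<^esub> bar g = u \<otimes>\<^bsub>B\<^esub> emb a"
      using uab by blast
  next
    assume "\<exists>u\<in>Units B. \<exists>a\<in>nonzero A. f \<otimes>\<^bsub>B\<^esub> bar g = u \<otimes>\<^bsub>B\<^esub> emb a"
    then obtain u a where ua: "u \<in> Units B" "a \<in> nonzero A" "f \<otimes>\<^bsub>B\<^esub> bar g = u \<otimes>\<^bsub>B\<^esub> emb a"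
      by blast
    have "f \<otimes>\<^bsub>B\<^esub> emb n = u \<otimes>\<^bsub>B\<^esub> emb a \<otimes>\<^bsub>B\<^esub> g"
      using car by (simp add: n(2)[symmetric] ua(3)[symmetric] B.m_ac)
    then have "fraction B f g = fraction B (u \<otimes>\<^bsub>B\<^esub> emb a) (emb n)"
      using f g n ua car B.Units_nonzero[of u] emb_nonzero[of a]
      by (simp add: B.fraction_eq_iff B.nonzero_closed)
    then show "fraction B f g \<in> polar_kernel A"
      unfolding polar_kernel_eq using n ua by blast
  qed
qed

lemma polar_coset_eq_iff:
  assumes "x \<in> carrier (L_units A)" "y \<in> carrier (L_units A)"
  shows "polar_kernel A #>\<^bsub>L_units A\<^esub> x = polar_kernel A #>\<^bsub>L_units A\<^esub> y \<longleftrightarrow>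
    x \<otimes>\<^bsub>L_units A\<^esub> inv\<^bsub>L_units A\<^esub> y \<in> polar_kernel A"
proof
  assume "polar_kernel A #>\<^bsub>L_units A\<^esub> x = polar_kernel A #>\<^bsub>L_units A\<^esub> y"
  then have "x \<in> polar_kernel A #>\<^bsub>L_units A\<^esub> y"
    using L.rcos_self[OF assms(1) subgroup_polar_kernel] by simp
  then show "x \<otimes>\<^bsub>L_units A\<^esub> inv\<^bsub>L_units A\<^esub> y \<in> polar_kernel A"
    by (rule subgroup.rcos_module_imp[OF subgroup_polar_kernel L.is_group assms(2)])
next
  assume "x \<otimes>\<^bsub>L_units A\<^esub> inv\<^bsub>L_units A\<^esub> y \<in> polar_kernel A"
  then have "x \<in> polar_kernel A #>\<^bsub>L_units A\<^esub> y"
    by (rule subgroup.rcos_module_rev[OF subgroup_polar_kernel L.is_group assms(2,1)])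
  then show "polar_kernel A #>\<^bsub>L_units A\<^esub> x = polar_kernel A #>\<^bsub>L_units A\<^esub> y"
    using L.repr_independence[OF _ assms(2) subgroup_polar_kernel] by simp
qed

lemma polar_class_eq_iff:
  assumes "f \<in> nonzero B" "g \<in> nonzero B"
  shows "polar_class A f = polar_class A g \<longleftrightarrow>
    (\<exists>u\<in>Units B. \<exists>a\<in>nonzero A. f \<otimes>\<^bsub>B\<^esub> bar g = u \<otimes>\<^bsub>B\<^esub> emb a)"
proof -
  have "fraction B f \<one>\<^bsub>B\<^esub> \<otimes>\<^bsub>L_units A\<^esub> inv\<^bsub>L_units A\<^esub> fraction B g \<one>\<^bsub>B\<^esub> = fraction B f g"
    using assms by (simp add: inv_L mult_L B.nonzero_closed)
  then show ?thesis
    unfolding polar_class_def fraction_in_polar_kernel_iff[OF assms, symmetric]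
    using assms polar_coset_eq_iff[of "fraction B f \<one>\<^bsub>B\<^esub>" "fraction B g \<one>\<^bsub>B\<^esub>"] by simp
qed

lemma comm_group_polar: "comm_group (polar_group A)"
  unfolding polar_group_def using subgroup_polar_kernel by (rule L.abelian_FactGroup)

sublocale P: comm_group "polar_group A"
  by (rule comm_group_polar)

lemma normal_polar_kernel: "polar_kernel A \<lhd> L_units A"
  by (rule L.subgroup_imp_normal[OF subgroup_polar_kernel])

lemma polar_class_mult:
  assumes "f \<in> nonzero B" "g \<in> nonzero B"
  shows "polar_class A (f \<otimes>\<^bsub>B\<^esub> g) = polar_class A f \<otimes>\<^bsub>polar_group A\<^esub> polar_class A g"
proof -
  have "polar_class A f \<otimes>\<^bsub>polar_group A\<^esub> polar_class A g =
      polar_kernel A #>\<^bsub>L_units A\<^esub> (fraction B f \<one>\<^bsub>B\<^esub> \<otimes>\<^bsub>L_units A\<^esub> fraction B g \<one>\<^bsub>B\<^esub>)"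
    unfolding polar_class_def polar_group_def mult_FactGroup
    by (rule normal.rcos_sum[OF normal_polar_kernel]) (simp_all add: assms)
  then show ?thesis
    using assms by (simp add: mult_L polar_class_def)
qed

lemma polar_class_one: "polar_class A \<one>\<^bsub>B\<^esub> = \<one>\<^bsub>polar_group A\<^esub>"
  unfolding polar_class_def polar_group_def one_FactGroup one_L[symmetric]
  by (rule L.coset_mult_one[OF subgroup.subset[OF subgroup_polar_kernel]])

lemma polar_class_eq_one_iff:
  assumes "f \<in> nonzero B"
  shows "polar_class A f = \<one>\<^bsub>polar_group A\<^esub> \<longleftrightarrow> (\<exists>u\<in>Units B. \<exists>a\<in>nonzero A. f = u \<otimes>\<^bsub>B\<^esub> emb a)"
  using assms polar_class_eq_iff[of f "\<one>\<^bsub>B\<^esub>"] by (simp add: polar_class_one B.nonzero_closed)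

lemma carrier_polar_group: "carrier (polar_group A) = polar_class A ` nonzero B"
proof
  show "polar_class A ` nonzero B \<subseteq> carrier (polar_group A)"
    by (auto simp: polar_class_def polar_group_def carrier_FactGroup)
  show "carrier (polar_group A) \<subseteq> polar_class A ` nonzero B"
  proof
    fix x assume "x \<in> carrier (polar_group A)"
    then obtain f g where fg: "f \<in> nonzero B" "g \<in> nonzero B"
      and x: "x = polar_kernel A #>\<^bsub>L_units A\<^esub> fraction B f g"
      by (auto simp: polar_group_def carrier_FactGroup carrier_L)
    \<comment> \<open>The representative without denominator is \<open>f * bar g\<close>. To compare
      it with \<open>f/g\<close>, the kernel criterion is applied to \<open>f\<close> over
      \<open>g * (f * bar g)\<close>, and the product to be tested is exactly the norm of
      \<open>f * bar g\<close>.\<close>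
    obtain n where n: "n \<in> nonzero A" "(f \<otimes>\<^bsub>B\<^esub> bar g) \<otimes>\<^bsub>B\<^esub> bar (f \<otimes>\<^bsub>B\<^esub> bar g) = emb n"
      using norm_nonzero[of "f \<otimes>\<^bsub>B\<^esub> bar g"] fg by auto
    have "f \<otimes>\<^bsub>B\<^esub> bar (g \<otimes>\<^bsub>B\<^esub> (f \<otimes>\<^bsub>B\<^esub> bar g)) = \<one>\<^bsub>B\<^esub> \<otimes>\<^bsub>B\<^esub> emb n"
      using n fg by (simp add: bar_mult B.nonzero_closed A.nonzero_closed B.m_assoc)
    then have "fraction B f (g \<otimes>\<^bsub>B\<^esub> (f \<otimes>\<^bsub>B\<^esub> bar g)) \<in> polar_kernel A"
      using fg n B.Units_one_closed
      by (subst fraction_in_polar_kernel_iff) (auto intro!: bexI[of _ "\<one>\<^bsub>B\<^esub>"] bexI[of _ n])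
    then have "x = polar_class A (f \<otimes>\<^bsub>B\<^esub> bar g)"
      unfolding x polar_class_def using fg
      by (subst polar_coset_eq_iff) (simp_all add: inv_L mult_L B.nonzero_closed)
    then show "x \<in> polar_class A ` nonzero B"
      using fg by simp
  qed
qed

lemma polar_class_closed [simp]: "f \<in> nonzero B \<Longrightarrow> polar_class A f \<in> carrier (polar_group A)"
  unfolding carrier_polar_group by blast

lemma polar_class_bar:
  assumes "f \<in> nonzero B"
  shows "polar_class A (bar f) = inv\<^bsub>polar_group A\<^esub> polar_class A f"
proof -
  obtain n where n: "n \<in> nonzero A" "f \<otimes>\<^bsub>B\<^esub> bar f = emb n"
    using norm_nonzero[OF assms] by blast
  have "polar_class A (f \<otimes>\<^bsub>B\<^esub> bar f) = \<one>\<^bsub>polar_group A\<^esub>"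
    using assms n A.nonzero_closed[of n]
    by (subst polar_class_eq_one_iff) (auto intro!: bexI[of _ "\<one>\<^bsub>B\<^esub>"] bexI[of _ n])
  then have "polar_class A f \<otimes>\<^bsub>polar_group A\<^esub> polar_class A (bar f) = \<one>\<^bsub>polar_group A\<^esub>"
    using assms by (simp add: polar_class_mult)
  then show ?thesis
    using assms P.inv_equality[of "polar_class A (bar f)" "polar_class A f"]
    by (simp add: P.m_comm)
qed

lemma polar_class_unit_mult:
  assumes "u \<in> Units B" "f \<in> nonzero B"
  shows "polar_class A (u \<otimes>\<^bsub>B\<^esub> f) = polar_class A f"
proof -
  have "polar_class A u = \<one>\<^bsub>polar_group A\<^esub>"
    using assms B.Units_nonzero A.nonzero_one emb_one
    by (subst polar_class_eq_one_iff) (auto intro!: bexI[of _ u] bexI[of _ \<one>])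
  then show ?thesis
    using assms by (simp add: polar_class_mult B.Units_nonzero)
qed


subsection \<open>Invariant prime ideals\<close>

lemma nonzero_factors:
  assumes "f \<otimes>\<^bsub>B\<^esub> g \<in> nonzero B" "f \<in> carrier B" "g \<in> carrier B"
  shows "f \<in> nonzero B" "g \<in> nonzero B"
  using assms by (auto simp: nonzero_def B.integral_iff)

lemma irreducible_nonzero:
  assumes "p \<in> carrier B" "ring_irreducible\<^bsub>B\<^esub> p"
  shows "p \<in> nonzero B"
  using assms by (simp add: nonzero_def ring_irreducible_def)

section \<open>Elements without real divisor\<close>

lemma Delta_iff:
  "f \<in> Delta A \<longleftrightarrow> f \<in> nonzero B \<and>
    (\<forall>r\<in>nonzero A. emb r divides\<^bsub>B\<^esub> f \<longrightarrow> r \<in> Units A)"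
proof -
  have "f \<in> PIdl\<^bsub>B\<^esub> (emb r) \<longleftrightarrow> emb r divides\<^bsub>B\<^esub> f" if "r \<in> nonzero A" for r
  proof -
    have "emb r \<in> carrier B"
      using that by (simp add: A.nonzero_closed)
    then show ?thesis
      unfolding cgenideal_def factor_def using B.m_comm by blast
  qed
  then show ?thesis
    unfolding Delta_def by blast
qed

lemma Delta_nonzero: "f \<in> Delta A \<Longrightarrow> f \<in> nonzero B"
  by (simp add: Delta_iff)

lemma Delta_associated:
  assumes "f \<in> Delta A" "g \<in> carrier B" "g \<sim>\<^bsub>B\<^esub> f"
  shows "g \<in> Delta A"
proof -
  have f: "f \<in> carrier B" "f \<noteq> \<zero>\<^bsub>B\<^esub>"
    using Delta_nonzero[OF assms(1)] by (auto simp: nonzero_def)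
  have gf: "g divides\<^bsub>B\<^esub> f"
    using assms(3) by (simp add: associated_def)
  have "g \<in> nonzero B"
    using gf f(2) assms(2) B.zero_divides by (auto simp: nonzero_def)
  moreover have "r \<in> Units A" if "r \<in> nonzero A" "emb r divides\<^bsub>B\<^esub> g" for r
  proof -
    have "emb r divides\<^bsub>B\<^esub> f"
      using B.divides_trans[OF that(2) gf] that(1) by (simp add: A.nonzero_closed)
    then show ?thesis
      using assms(1) that(1) by (simp add: Delta_iff)
  qed
  ultimately show ?thesis
    by (simp add: Delta_iff)
qed

lemma Delta_bar:
  assumes "f \<in> Delta A"
  shows "bar f \<in> Delta A"
proof -
  have f: "f \<in> nonzero B" "f \<in> carrier B"
    using Delta_nonzero[OF assms] B.nonzero_closed by auto
  have "r \<in> Units A" if "r \<in> nonzero A" "emb r divides\<^bsub>B\<^esub> bar f" for r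
    using bar_divides[OF _ that(2)] that(1) f assms by (simp add: A.nonzero_closed Delta_iff)
  then show ?thesis
    using f by (simp add: Delta_iff)
qed

text \<open>A nonunit real divisor of an irreducible element is associated to it, so an irreducible
  fails to lie in \<Delta>(B) only by being real up to a unit.\<close>

lemma irreducible_in_Delta_iff:
  assumes p: "p \<in> carrier B" "ring_irreducible\<^bsub>B\<^esub> p"
  shows "p \<in> Delta A \<longleftrightarrow> \<not> (\<exists>a\<in>nonzero A. p \<sim>\<^bsub>B\<^esub> emb a)"
proof
  assume pD: "p \<in> Delta A"
  show "\<not> (\<exists>a\<in>nonzero A. p \<sim>\<^bsub>B\<^esub> emb a)"
  proof
    assume "\<exists>a\<in>nonzero A. p \<sim>\<^bsub>B\<^esub> emb a"
    then obtain a where a: "a \<in> nonzero A" "p \<sim>\<^bsub>B\<^esub> emb a"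
      by blast
    then have "a \<in> Units A"
      using pD by (simp add: Delta_iff associated_def)
    then have "emb a \<in> Units B"
      using a emb_unit_iff A.nonzero_closed by blast
    then have "p \<in> Units B"
      using a(2) p(1) B.Units_cong B.associated_sym by blast
    then show False
      using B.ring_irreducibleE(4)[OF p] by simp
  qed
next
  assume real: "\<not> (\<exists>a\<in>nonzero A. p \<sim>\<^bsub>B\<^esub> emb a)"
  have "r \<in> Units A" if r: "r \<in> nonzero A" "emb r divides\<^bsub>B\<^esub> p" for r
  proof (rule ccontr)
    assume "r \<notin> Units A"
    then have nu: "emb r \<notin> Units B"
      using r emb_unit_iff A.nonzero_closed by blast
    have er: "emb r \<in> carrier B"
      using r A.nonzero_closed by simp
    obtain c where c: "c \<in> carrier B" "p = emb r \<otimes>\<^bsub>B\<^esub> c"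
      using r(2) by (auto simp: factor_def)
    then have "c \<in> Units B"
      using B.ring_irreducibleE(5)[OF p er] nu by blast
    then have "p \<sim>\<^bsub>B\<^esub> emb r"
      using c er p(1) B.ring_associated_iff[OF p(1) er] B.m_comm by blast
    then show False
      using real r(1) by blast
  qed
  then show "p \<in> Delta A"
    using irreducible_nonzero[OF p] by (simp add: Delta_iff)
qed

section \<open>Real factors and the existence of polar factorizations\<close>

lemma polar_class_emb_mult:
  assumes "a \<in> nonzero A" "f \<in> nonzero B"
  shows "polar_class A (emb a \<otimes>\<^bsub>B\<^esub> f) = polar_class A f"
proof -
  have "polar_class A (emb a) = \<one>\<^bsub>polar_group A\<^esub>"
    using assms A.nonzero_closed[of a]
    by (subst polar_class_eq_one_iff) (auto intro!: bexI[of _ "\<one>\<^bsub>B\<^esub>"] bexI[of _ a])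
  then show ?thesis
    using assms by (simp add: polar_class_mult)
qed

lemma polar_class_associated:
  assumes "f \<in> nonzero B" "g \<in> nonzero B" "f \<sim>\<^bsub>B\<^esub> g"
  shows "polar_class A f = polar_class A g"
proof -
  obtain u where "u \<in> Units B" "f = u \<otimes>\<^bsub>B\<^esub> g"
    using assms B.ring_associated_iff[of f g] B.nonzero_closed by blast
  then show ?thesis
    using polar_class_unit_mult assms(2) by simp
qed

text \<open>Well-founded induction on proper divisibility, as provided by the factorial monoid:
  splitting off a nonunit real divisor \<open>r\<close> leaves a proper divisor, and the real
  factors are collected in \<open>\<alpha>\<close>.\<close>

lemma polar_factorization_exists:
  assumes "f \<in> nonzero B"
  shows "\<exists>\<alpha> h. polar_factorization A f \<alpha> h"
  using assms
proof (induction f rule: wf_induct_rule[OF B.mult.division_wellfounded])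
  case (1 f)
  show ?case
  proof (cases "f \<in> Delta A")
    case True
    then have "polar_factorization A f \<one> f"
      using 1(2) by (simp add: polar_factorization_def emb_one B.nonzero_closed)
    then show ?thesis
      by blast
  next
    case False
    then obtain r where r: "r \<in> nonzero A" "emb r divides\<^bsub>B\<^esub> f" "r \<notin> Units A"
      using 1(2) by (auto simp: Delta_iff)
    obtain c where c: "c \<in> carrier B" "f = emb r \<otimes>\<^bsub>B\<^esub> c"
      using r(2) by (auto simp: factor_def)
    have er: "emb r \<in> carrier B" "r \<in> carrier A"
      using r A.nonzero_closed by auto
    have cnz: "c \<in> nonzero B"
      using nonzero_factors[of "emb r" c] 1(2) c er by simp
    \<comment> \<open>Properness of the divisor \<open>c\<close>: otherwise \<open>c\<close> could
      be cancelled from \<open>c = emb r * c * d\<close>, making \<open>emb r\<close> a unit of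
      \<open>B\<close> and \<open>r\<close> a unit of \<open>A\<close>.\<close>
    have "\<not> f divides\<^bsub>B\<^esub> c"
    proof
      assume "f divides\<^bsub>B\<^esub> c"
      then obtain d where d: "d \<in> carrier B" "c = f \<otimes>\<^bsub>B\<^esub> d"
        by (auto simp: factor_def)
      have "c \<otimes>\<^bsub>B\<^esub> (emb r \<otimes>\<^bsub>B\<^esub> d) = emb r \<otimes>\<^bsub>B\<^esub> c \<otimes>\<^bsub>B\<^esub> d"
        using c(1) d(1) er by (simp add: B.m_ac)
      also have "\<dots> = c"
        by (rule d(2)[unfolded c(2), symmetric])
      also have "\<dots> = c \<otimes>\<^bsub>B\<^esub> \<one>\<^bsub>B\<^esub>"
        using c(1) by simp
      finally have "c \<otimes>\<^bsub>B\<^esub> (emb r \<otimes>\<^bsub>B\<^esub> d) = c \<otimes>\<^bsub>B\<^esub> \<one>\<^bsub>B\<^esub>" .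
      then have "emb r \<otimes>\<^bsub>B\<^esub> d = \<one>\<^bsub>B\<^esub>"
        using B.m_lcancel[of c "emb r \<otimes>\<^bsub>B\<^esub> d" "\<one>\<^bsub>B\<^esub>"] cnz c(1) d(1) er
        by (simp add: nonzero_def)
      then have "emb r divides\<^bsub>B\<^esub> \<one>\<^bsub>B\<^esub>"
        using d(1) by (metis dividesI')
      then show False
        using B.divides_one[OF er(1)] emb_unit_iff[OF er(2)] r(3) by simp
    qed
    then have "\<not> f divides\<^bsub>mult_of B\<^esub> c"
      by (rule contrapos_nn) (rule divides_mult_imp_divides)
    moreover have "f = c \<otimes>\<^bsub>B\<^esub> emb r"
      using c B.m_comm[OF er(1) c(1)] by simp
    then have "c divides\<^bsub>B\<^esub> f"
      using er(1) by (rule dividesI')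
    then have "c divides\<^bsub>mult_of B\<^esub> f"
      using B.divides_imp_divides_mult[OF c(1)] 1(2) by (simp add: nonzero_def)
    ultimately have "properfactor (mult_of B) c f"
      by (simp add: properfactor_def)
    then obtain \<alpha> h where h: "polar_factorization A c \<alpha> h"
      using 1(1)[of c] 1(2) cnz by (auto simp: nonzero_def)
    have "polar_factorization A f (r \<otimes> \<alpha>) h"
      using h r(1) er c(2) Delta_nonzero[of h]
      by (simp add: polar_factorization_def emb_mult A.nonzero_closed B.nonzero_closed B.m_assoc)
    then show ?thesis
      by blast
  qed
qed

section \<open>Coprimality of an element with its conjugate\<close>

definition invariant_irreducibles_real :: bool where
  "invariant_irreducibles_real \<longleftrightarrow> (\<forall>p\<in>carrier B. ring_irreducible\<^bsub>B\<^esub> p \<and> p \<sim>\<^bsub>B\<^esub> bar p \<longrightarrow>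
     (\<exists>a\<in>nonzero A. p \<sim>\<^bsub>B\<^esub> emb a))"

definition Delta_iff_coprime :: bool where
  "Delta_iff_coprime \<longleftrightarrow>
     (\<forall>f\<in>nonzero B. f \<in> Delta A \<longleftrightarrow> \<one>\<^bsub>B\<^esub> gcdof\<^bsub>B\<^esub> f (bar f))"

definition polar_classes_separate_ideals :: bool where
  "polar_classes_separate_ideals \<longleftrightarrow>
     (\<forall>f\<in>Delta A. \<forall>g\<in>Delta A. polar_class A f = polar_class A g \<longleftrightarrow> PIdl\<^bsub>B\<^esub> f = PIdl\<^bsub>B\<^esub> g)"

text \<open>Polar classes ignore units, so associated elements always share a class; only the other
  implication carries information.\<close>

lemma polar_classes_separate_ideals_iff:
  "polar_classes_separate_ideals \<longleftrightarrow>
    (\<forall>f\<in>Delta A. \<forall>g\<in>Delta A. polar_class A f = polar_class A g \<longrightarrow> f \<sim>\<^bsub>B\<^esub> g)"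
proof -
  have "PIdl\<^bsub>B\<^esub> f = PIdl\<^bsub>B\<^esub> g \<longleftrightarrow> f \<sim>\<^bsub>B\<^esub> g"
    if "f \<in> Delta A" "g \<in> Delta A" for f g
    using B.associated_iff_same_ideal[of f g] that[THEN Delta_nonzero, THEN B.nonzero_closed]
    by simp
  moreover have "polar_class A f = polar_class A g"
    if "f \<in> Delta A" "g \<in> Delta A" "f \<sim>\<^bsub>B\<^esub> g" for f g
    by (rule polar_class_associated[OF that(1,2)[THEN Delta_nonzero] that(3)])
  ultimately show ?thesis
    unfolding polar_classes_separate_ideals_def by (meson)
qed

text \<open>Either case gives a real divisor of \<open>f\<close> that \<open>p\<close> divides, so
  \<open>p\<close> would be a unit. If \<open>p\<close> and \<open>bar p\<close> are not associated,
  both divide \<open>f\<close> and primality makes their product, a norm, divide \<open>f\<close>.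
  If they are associated, the real associate of \<open>p\<close> granted by the hypothesis is such a
  divisor.\<close>

lemma no_common_irreducible_divisor:
  assumes N: invariant_irreducibles_real and f: "f \<in> Delta A"
    and p: "p \<in> carrier B" "ring_irreducible\<^bsub>B\<^esub> p"
    and dvd: "p divides\<^bsub>B\<^esub> f" "p divides\<^bsub>B\<^esub> bar f"
  shows False
proof -
  have fc: "f \<in> carrier B"
    using Delta_nonzero[OF f] B.nonzero_closed by blast
  have unit: False if "a \<in> nonzero A" "emb a divides\<^bsub>B\<^esub> f" "p divides\<^bsub>B\<^esub> emb a" for a
  proof -
    have "a \<in> Units A"
      using f that by (simp add: Delta_iff)
    then have "emb a \<in> Units B"
      using that(1) emb_unit_iff A.nonzero_closed by blast
    then have "p \<in> Units B"
      using B.divides_unit[OF that(3)] p(1) by blast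
    then show False
      using B.ring_irreducibleE(4)[OF p] by simp
  qed
  show False
  proof (cases "p \<sim>\<^bsub>B\<^esub> bar p")
    case True
    then obtain a where a: "a \<in> nonzero A" "p \<sim>\<^bsub>B\<^esub> emb a"
      using N p by (auto simp: invariant_irreducibles_real_def)
    then have "p divides\<^bsub>B\<^esub> emb a" "emb a divides\<^bsub>B\<^esub> p"
      by (auto simp: associated_def)
    then show False
      using unit[OF a(1)] B.divides_trans[OF _ dvd(1)] emb_closed[OF A.nonzero_closed[OF a(1)]]
      by simp
  next
    case False
    have barp: "bar p \<in> carrier B" "ring_irreducible\<^bsub>B\<^esub> (bar p)"
      using bar_irreducible[OF p] p(1) by auto
    have "bar p divides\<^bsub>B\<^esub> f"
      using bar_divides[OF p(1) dvd(2)] fc by simp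
    obtain c where c: "c \<in> carrier B" "f = p \<otimes>\<^bsub>B\<^esub> c"
      using dvd(1) by (auto simp: factor_def)
    have "\<not> bar p divides\<^bsub>B\<^esub> p"
      using B.irreducible_divides_irreducible[OF barp p] False B.associated_sym by blast
    then have "bar p divides\<^bsub>B\<^esub> c"
      using B.irreducible_divides_mult[OF barp p(1) c(1)] \<open>bar p divides\<^bsub>B\<^esub> f\<close> c(2) by blast
    then obtain d where d: "d \<in> carrier B" "c = bar p \<otimes>\<^bsub>B\<^esub> d"
      by (auto simp: factor_def)
    obtain n where n: "n \<in> nonzero A" "p \<otimes>\<^bsub>B\<^esub> bar p = emb n"
      using norm_nonzero irreducible_nonzero[OF p] by blast
    have "f = emb n \<otimes>\<^bsub>B\<^esub> d"
      unfolding c(2) d(2) n(2)[symmetric] using p(1) barp(1) d(1) by (simp add: B.m_assoc)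
    then have "emb n divides\<^bsub>B\<^esub> f"
      using d(1) by (rule dividesI')
    moreover have "p divides\<^bsub>B\<^esub> emb n"
      using dividesI'[OF n(2)[symmetric]] barp(1) by blast
    ultimately show False
      using unit n(1) by blast
  qed
qed

text \<open>Conjugation fixes real elements, so a real divisor of \<open>f\<close> is a common
  divisor of \<open>f\<close> and \<open>bar f\<close>. This is the unconditional half of condition
  (2).\<close>

lemma Delta_if_coprime:
  assumes "f \<in> nonzero B" "\<one>\<^bsub>B\<^esub> gcdof\<^bsub>B\<^esub> f (bar f)"
  shows "f \<in> Delta A"
proof -
  have "r \<in> Units A" if r: "r \<in> nonzero A" "emb r divides\<^bsub>B\<^esub> f" for r
  proof -
    have er: "r \<in> carrier A" "emb r \<in> carrier B"
      using r A.nonzero_closed by auto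
    have "emb r divides\<^bsub>B\<^esub> bar f"
      using bar_divides[OF er(2) r(2)] by simp
    then have "emb r divides\<^bsub>B\<^esub> \<one>\<^bsub>B\<^esub>"
      using assms(2) r(2) er(2) by (auto simp: isgcd_def)
    then show ?thesis
      using B.divides_one[OF er(2)] emb_unit_iff[OF er(1)] by simp
  qed
  then show ?thesis
    using assms(1) by (simp add: Delta_iff)
qed

lemma invariant_irreducibles_real_imp_Delta_iff_coprime:
  assumes N: invariant_irreducibles_real
  shows Delta_iff_coprime
  unfolding Delta_iff_coprime_def
proof (intro ballI iffI)
  fix f assume f: "f \<in> nonzero B" "f \<in> Delta A"
  have "y divides\<^bsub>B\<^esub> \<one>\<^bsub>B\<^esub>"
    if y: "y \<in> carrier B" "y divides\<^bsub>B\<^esub> f" "y divides\<^bsub>B\<^esub> bar f" for y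
  proof (rule ccontr)
    assume "\<not> y divides\<^bsub>B\<^esub> \<one>\<^bsub>B\<^esub>"
    then have "y \<notin> Units B"
      using B.divides_one[OF y(1)] by blast
    moreover have "y \<in> carrier B - {\<zero>\<^bsub>B\<^esub>}"
      using y f(1) B.zero_divides[of f] by (auto simp: nonzero_def)
    ultimately obtain p where p: "p \<in> carrier B" "ring_irreducible\<^bsub>B\<^esub> p" "p divides\<^bsub>B\<^esub> y"
      using B.irreducible_divisor_exists by blast
    then show False
      using no_common_irreducible_divisor[OF N f(2) p(1,2)] B.divides_trans[OF p(3)] y p(1) by blast
  qed
  then show "\<one>\<^bsub>B\<^esub> gcdof\<^bsub>B\<^esub> f (bar f)"
    using f(1) B.nonzero_closed by (auto simp: isgcd_def B.one_divides)
qed (rule Delta_if_coprime)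

text \<open>An invariant irreducible that is not real up to a unit would lie in \<Delta>(B) and yet
  divide its own conjugate.\<close>

lemma Delta_iff_coprime_imp_invariant_irreducibles_real:
  assumes Delta_iff_coprime
  shows invariant_irreducibles_real
  unfolding invariant_irreducibles_real_def
proof (intro ballI impI, rule ccontr)
  fix p assume p: "p \<in> carrier B" and "ring_irreducible\<^bsub>B\<^esub> p \<and> p \<sim>\<^bsub>B\<^esub> bar p"
    and real: "\<not> (\<exists>a\<in>nonzero A. p \<sim>\<^bsub>B\<^esub> emb a)"
  then have irr: "ring_irreducible\<^bsub>B\<^esub> p" and "p divides\<^bsub>B\<^esub> bar p"
    by (auto simp: associated_def)
  moreover have "\<one>\<^bsub>B\<^esub> gcdof\<^bsub>B\<^esub> p (bar p)"
    using assms irreducible_nonzero[OF p irr] irreducible_in_Delta_iff[OF p irr] real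
    by (auto simp: Delta_iff_coprime_def)
  ultimately have "p divides\<^bsub>B\<^esub> \<one>\<^bsub>B\<^esub>"
    using p by (auto simp: isgcd_def)
  then show False
    using B.divides_one[OF p] B.ring_irreducibleE(4)[OF p irr] by simp
qed

section \<open>Polar classes and principal ideals\<close>

lemma polar_class_eq_crossD:
  assumes "f \<in> nonzero B" "g \<in> nonzero B" "polar_class A f = polar_class A g"
  shows "f divides\<^bsub>B\<^esub> bar f \<otimes>\<^bsub>B\<^esub> g"
proof -
  obtain u a where ua: "u \<in> Units B" "a \<in> nonzero A" "f \<otimes>\<^bsub>B\<^esub> bar g = u \<otimes>\<^bsub>B\<^esub> emb a"
    using assms polar_class_eq_iff by blast
  have car: "f \<in> carrier B" "g \<in> carrier B" "u \<in> carrier B" "emb a \<in> carrier B"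
    "inv\<^bsub>B\<^esub> u \<in> carrier B" "bar u \<in> carrier B"
    using assms ua B.nonzero_closed A.nonzero_closed by auto
  \<comment> \<open>Equality of classes says that \<open>f * bar g\<close> is real up to a unit,
    hence it agrees with its conjugate \<open>bar f * g\<close> up to a unit; the former is visibly
    a multiple of \<open>f\<close>.\<close>
  have "bar f \<otimes>\<^bsub>B\<^esub> g = bar (f \<otimes>\<^bsub>B\<^esub> bar g)"
    using car by (simp add: bar_mult)
  also have "\<dots> = bar u \<otimes>\<^bsub>B\<^esub> emb a"
    using car by (simp add: ua(3) bar_mult)
  also have "emb a = inv\<^bsub>B\<^esub> u \<otimes>\<^bsub>B\<^esub> (u \<otimes>\<^bsub>B\<^esub> emb a)"
    using car ua(1) by (simp add: B.m_assoc[symmetric])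
  also have "\<dots> = inv\<^bsub>B\<^esub> u \<otimes>\<^bsub>B\<^esub> (f \<otimes>\<^bsub>B\<^esub> bar g)"
    by (simp add: ua(3))
  also have "bar u \<otimes>\<^bsub>B\<^esub> \<dots> = f \<otimes>\<^bsub>B\<^esub> (bar u \<otimes>\<^bsub>B\<^esub> (inv\<^bsub>B\<^esub> u \<otimes>\<^bsub>B\<^esub> bar g))"
    using car by (simp add: B.m_lcomm)
  finally show ?thesis
    by (rule dividesI') (use car in simp)
qed

text \<open>From \<open>f\<close> dividing \<open>bar f * g\<close>, coprimality of \<open>f\<close>
  and \<open>bar f\<close> removes the factor \<open>bar f\<close>. The argument is symmetric in
  \<open>f\<close> and \<open>g\<close>.\<close>

lemma invariant_irreducibles_real_imp_separate:
  assumes N: invariant_irreducibles_real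
  shows polar_classes_separate_ideals
proof -
  have dvd: "f divides\<^bsub>B\<^esub> g"
    if fg: "f \<in> Delta A" "g \<in> Delta A" "polar_class A f = polar_class A g" for f g
  proof (rule B.coprime_divides_mult)
    show "bar f \<in> carrier B - {\<zero>\<^bsub>B\<^esub>}"
      using bar_nonzero[OF Delta_nonzero[OF fg(1)]] by (simp add: nonzero_def)
    show "f \<in> carrier B" "g \<in> carrier B"
      using fg Delta_nonzero B.nonzero_closed by auto
    show "f divides\<^bsub>B\<^esub> bar f \<otimes>\<^bsub>B\<^esub> g"
      using polar_class_eq_crossD[OF _ _ fg(3)] Delta_nonzero fg(1,2) by blast
    show False if "p \<in> carrier B" "ring_irreducible\<^bsub>B\<^esub> p" "p divides\<^bsub>B\<^esub> f" "p divides\<^bsub>B\<^esub> bar f" for p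
      using no_common_irreducible_divisor[OF N fg(1) that] .
  qed
  show ?thesis
    unfolding polar_classes_separate_ideals_iff associated_def using dvd by simp
qed

text \<open>Because \<open>bar p\<close> is a unit multiple of \<open>p\<close>, also
  \<open>s * bar p\<close> is real up to a unit, so \<open>s\<close> and \<open>p\<close> have the
  same class. By hypothesis the \<Delta>(B)-part of \<open>s\<close> is then associated to
  \<open>p\<close>. The case \<open>s = 0\<close> is treated apart, since polar classes concern
  nonzero elements.\<close>

lemma separate_imp_divides_cofactor:
  assumes sep: polar_classes_separate_ideals
    and p: "p \<in> Delta A" and u: "u \<in> Units B" "bar p = u \<otimes>\<^bsub>B\<^esub> p"
    and s: "s \<in> carrier B" "v \<in> Units B" "a \<in> carrier A" "s \<otimes>\<^bsub>B\<^esub> p = v \<otimes>\<^bsub>B\<^esub> emb a"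
  shows "p divides\<^bsub>B\<^esub> s"
proof (cases "s = \<zero>\<^bsub>B\<^esub>")
  case True
  then show ?thesis
    using B.divides_zero[of p] p Delta_nonzero B.nonzero_closed by blast
next
  case False
  have pnz: "p \<in> nonzero B" and pc: "p \<in> carrier B"
    using Delta_nonzero[OF p] B.nonzero_closed by auto
  have snz: "s \<in> nonzero B"
    using False s(1) by (simp add: nonzero_def)
  have vc: "v \<in> carrier B" "u \<in> carrier B" "emb a \<in> carrier B"
    using s(2,3) u(1) by auto
  have "v \<otimes>\<^bsub>B\<^esub> emb a \<in> nonzero B"
    using snz pnz by (simp add: s(4)[symmetric])
  then have "emb a \<in> nonzero B"
    using nonzero_factors(2) vc by blast
  then have anz: "a \<in> nonzero A"
    using s(3) by (auto simp: nonzero_def embed_def zero_B)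
  have "s \<otimes>\<^bsub>B\<^esub> bar p = u \<otimes>\<^bsub>B\<^esub> (s \<otimes>\<^bsub>B\<^esub> p)"
    using s(1) pc vc by (simp add: u(2) B.m_lcomm)
  also have "\<dots> = (u \<otimes>\<^bsub>B\<^esub> v) \<otimes>\<^bsub>B\<^esub> emb a"
    using vc by (simp add: s(4) B.m_assoc)
  finally have sp: "polar_class A s = polar_class A p"
    using polar_class_eq_iff[OF snz pnz] u(1) s(2) anz B.Units_m_closed by blast
  obtain \<alpha> h where h: "\<alpha> \<in> nonzero A" "h \<in> Delta A" "s = emb \<alpha> \<otimes>\<^bsub>B\<^esub> h"
    using polar_factorization_exists[OF snz] by (auto simp: polar_factorization_def)
  have "polar_class A h = polar_class A p"
    using sp h Delta_nonzero[OF h(2)] by (simp add: polar_class_emb_mult)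
  then have "h \<sim>\<^bsub>B\<^esub> p"
    using sep h(2) p by (auto simp: polar_classes_separate_ideals_iff)
  then have "p divides\<^bsub>B\<^esub> h"
    by (simp add: associated_def)
  then show ?thesis
    unfolding h(3) using pc h(1,2) Delta_nonzero B.nonzero_closed emb_nonzero
    by (intro B.divides_prod_l) blast+
qed

text \<open>If \<open>bar p = u p\<close>, then \<open>(1 + u) p\<close> and \<open>(1 - u) p\<close> are twice the real part of \<open>p\<close> and \<open>2i\<close>
  times its imaginary part, so that \<open>1 + u\<close> and \<open>1 - u\<close> have the same polar class as \<open>p\<close>. Hence
  \<open>p\<close> divides both of them and their sum \<open>2\<close>.\<close>

lemma separate_imp_invariant_irreducibles_real:
  assumes sep: polar_classes_separate_ideals
  shows invariant_irreducibles_real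
  unfolding invariant_irreducibles_real_def
proof (intro ballI impI, rule ccontr)
  fix p assume p: "p \<in> carrier B" and "ring_irreducible\<^bsub>B\<^esub> p \<and> p \<sim>\<^bsub>B\<^esub> bar p"
    and "\<not> (\<exists>a\<in>nonzero A. p \<sim>\<^bsub>B\<^esub> emb a)"
  then have irr: "ring_irreducible\<^bsub>B\<^esub> p" and pD: "p \<in> Delta A" and "bar p \<sim>\<^bsub>B\<^esub> p"
    using irreducible_in_Delta_iff[OF p] B.associated_sym[of p "bar p"] by auto
  then obtain u where u: "u \<in> Units B" "bar p = u \<otimes>\<^bsub>B\<^esub> p"
    using B.ring_associated_iff[of "bar p" p] p by auto
  have uc: "u \<in> carrier B"
    using u by auto
  have fs: "fst p \<in> carrier A" "snd p \<in> carrier A"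
    using p by (auto simp: carrier_B)
  define s where "s = \<one>\<^bsub>B\<^esub> \<oplus>\<^bsub>B\<^esub> u"
  define d where "d = \<one>\<^bsub>B\<^esub> \<ominus>\<^bsub>B\<^esub> u"
  have sd: "s \<in> carrier B" "d \<in> carrier B"
    using uc by (auto simp: s_def d_def)
  have "s \<otimes>\<^bsub>B\<^esub> p = p \<oplus>\<^bsub>B\<^esub> bar p"
    using p uc by (simp add: s_def B.l_distr u(2))
  also have "\<dots> = \<one>\<^bsub>B\<^esub> \<otimes>\<^bsub>B\<^esub> emb (fst p \<oplus> fst p)"
    using p fs by (simp add: add_conj)
  finally have "p divides\<^bsub>B\<^esub> s"
    using separate_imp_divides_cofactor[OF sep pD u sd(1) B.Units_one_closed] fs by blast
  moreover have "d \<otimes>\<^bsub>B\<^esub> p = p \<ominus>\<^bsub>B\<^esub> bar p"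
    using p uc by (simp add: d_def B.minus_eq B.l_distr u(2) B.l_minus)
  then have "d \<otimes>\<^bsub>B\<^esub> p = imag \<otimes>\<^bsub>B\<^esub> emb (snd p \<oplus> snd p)"
    using p by (simp add: diff_conj)
  then have "p divides\<^bsub>B\<^esub> d"
    using separate_imp_divides_cofactor[OF sep pD u sd(2) i_unit] fs by blast
  ultimately obtain c e where ce: "c \<in> carrier B" "e \<in> carrier B" "s = p \<otimes>\<^bsub>B\<^esub> c" "d = p \<otimes>\<^bsub>B\<^esub> e"
    by (auto simp: factor_def)
  have "p \<otimes>\<^bsub>B\<^esub> (c \<oplus>\<^bsub>B\<^esub> e) = s \<oplus>\<^bsub>B\<^esub> d"
    using p ce by (simp add: B.r_distr)
  also have "\<dots> = \<one>\<^bsub>B\<^esub> \<oplus>\<^bsub>B\<^esub> (\<one>\<^bsub>B\<^esub> \<oplus>\<^bsub>B\<^esub> (u \<oplus>\<^bsub>B\<^esub> \<ominus>\<^bsub>B\<^esub> u))"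
    using uc by (simp add: s_def d_def B.minus_eq B.a_ac del: B.r_neg)
  also have "\<dots> = emb (\<one> \<oplus> \<one>)"
    using uc by (simp add: B.r_neg) (simp add: one_B add_B embed_def)
  finally have "p divides\<^bsub>B\<^esub> emb (\<one> \<oplus> \<one>)"
    using ce(1,2) by (metis B.a_closed dividesI')
  moreover have "emb (\<one> \<oplus> \<one>) \<in> Units B"
    using two_unit emb_unit_iff by simp
  ultimately have "p \<in> Units B"
    using B.divides_unit p by blast
  then show False
    using B.ring_irreducibleE(4)[OF p irr] by simp
qed

section \<open>Uniqueness of polar factorizations\<close>

lemma unique_polar_factorization_imp_separate:
  assumes unique: "\<forall>f\<in>nonzero B. has_unique_polar_factorization A f"
  shows polar_classes_separate_ideals
  unfolding polar_classes_separate_ideals_iff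
proof (intro ballI impI)
  fix f g assume fg: "f \<in> Delta A" "g \<in> Delta A" "polar_class A f = polar_class A g"
  have nz: "f \<in> nonzero B" "g \<in> nonzero B" and car: "f \<in> carrier B" "g \<in> carrier B"
    using fg Delta_nonzero B.nonzero_closed by auto
  obtain u a where ua: "u \<in> Units B" "a \<in> nonzero A" "f \<otimes>\<^bsub>B\<^esub> bar g = u \<otimes>\<^bsub>B\<^esub> emb a"
    using fg(3) polar_class_eq_iff[OF nz] by blast
  obtain n where n: "n \<in> nonzero A" "g \<otimes>\<^bsub>B\<^esub> bar g = emb n"
    using norm_nonzero[OF nz(2)] by blast
  have car': "u \<in> carrier B" "emb a \<in> carrier B" "emb n \<in> carrier B" "u \<otimes>\<^bsub>B\<^esub> g \<in> carrier B"
    using ua n A.nonzero_closed car by auto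
  have ug: "u \<otimes>\<^bsub>B\<^esub> g \<sim>\<^bsub>B\<^esub> g"
    using ua(1) car car' B.ring_associated_iff by blast
  \<comment> \<open>Equality of classes is turned into two polar factorizations of a single element:
    \<open>f\<close> times the norm of \<open>g\<close> is also \<open>a\<close> times
    \<open>u * g\<close>.\<close>
  have "emb n \<otimes>\<^bsub>B\<^esub> f = (f \<otimes>\<^bsub>B\<^esub> bar g) \<otimes>\<^bsub>B\<^esub> g"
    unfolding n(2)[symmetric] using car by (simp add: B.m_ac)
  also have "\<dots> = emb a \<otimes>\<^bsub>B\<^esub> (u \<otimes>\<^bsub>B\<^esub> g)"
    using car car' by (simp add: ua(3) B.m_ac)
  finally have "polar_factorization A (emb n \<otimes>\<^bsub>B\<^esub> f) a (u \<otimes>\<^bsub>B\<^esub> g)"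
    using ua(2) Delta_associated[OF fg(2) car'(4) ug] by (simp add: polar_factorization_def)
  moreover have "polar_factorization A (emb n \<otimes>\<^bsub>B\<^esub> f) n f"
    using n(1) fg(1) by (simp add: polar_factorization_def)
  moreover have "has_unique_polar_factorization A (emb n \<otimes>\<^bsub>B\<^esub> f)"
    using unique n(1) nz(1) by simp
  ultimately have "PIdl\<^bsub>B\<^esub> f = PIdl\<^bsub>B\<^esub> (u \<otimes>\<^bsub>B\<^esub> g)"
    unfolding has_unique_polar_factorization_def by blast
  then have "f \<sim>\<^bsub>B\<^esub> u \<otimes>\<^bsub>B\<^esub> g"
    using B.associated_iff_same_ideal car car' by blast
  then show "f \<sim>\<^bsub>B\<^esub> g"
    using ug B.associated_trans car car' by blast
qed

text \<open>Real factors do not change the class, so both \<Delta>(B)-parts have the class of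
  \<open>f\<close> and are associated. The unit between them is a quotient of real elements, hence a
  unit of \<open>A\<close>, and this settles the real parts as well.\<close>

lemma separate_imp_unique_polar_factorization:
  assumes sep: polar_classes_separate_ideals and f: "f \<in> nonzero B"
  shows "has_unique_polar_factorization A f"
  unfolding has_unique_polar_factorization_def
proof (intro conjI allI impI polar_factorization_exists[OF f])
  fix \<alpha> h \<beta> g
  assume "polar_factorization A f \<alpha> h \<and> polar_factorization A f \<beta> g"
  then have nz: "\<alpha> \<in> nonzero A" "\<beta> \<in> nonzero A" and D: "h \<in> Delta A" "g \<in> Delta A"
    and eq: "f = emb \<alpha> \<otimes>\<^bsub>B\<^esub> h" "f = emb \<beta> \<otimes>\<^bsub>B\<^esub> g"
    by (auto simp: polar_factorization_def)
  have Dnz: "h \<in> nonzero B" "g \<in> nonzero B"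
    using D Delta_nonzero by auto
  have car: "\<alpha> \<in> carrier A" "\<beta> \<in> carrier A" "h \<in> carrier B" "g \<in> carrier B"
    "emb \<alpha> \<in> carrier B" "emb \<beta> \<in> carrier B" "g \<noteq> \<zero>\<^bsub>B\<^esub>"
    using nz Dnz A.nonzero_closed B.nonzero_closed by (auto simp: nonzero_def)
  have "polar_class A h = polar_class A g"
    using polar_class_emb_mult[OF nz(1) Dnz(1)] polar_class_emb_mult[OF nz(2) Dnz(2)] eq by simp
  then have hg: "h \<sim>\<^bsub>B\<^esub> g"
    using sep D by (auto simp: polar_classes_separate_ideals_iff)
  then show "PIdl\<^bsub>B\<^esub> h = PIdl\<^bsub>B\<^esub> g"
    using B.associated_iff_same_ideal car by blast
  obtain u where u: "u \<in> Units B" "h = u \<otimes>\<^bsub>B\<^esub> g"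
    using hg B.ring_associated_iff car by blast
  have uc: "u \<in> carrier B"
    using u by auto
  have "g \<otimes>\<^bsub>B\<^esub> (emb \<alpha> \<otimes>\<^bsub>B\<^esub> u) = g \<otimes>\<^bsub>B\<^esub> emb \<beta>"
    using eq u(2) car uc by (simp add: B.m_ac)
  then have "emb \<alpha> \<otimes>\<^bsub>B\<^esub> u = emb \<beta>"
    using B.m_lcancel car uc by simp
  then obtain c where c: "c \<in> carrier A" "u = emb c" "\<alpha> \<otimes> c = \<beta>"
    using emb_cofactor[OF nz(1) uc] by blast
  then have "c \<in> Units A"
    using u(1) emb_unit_iff by blast
  then have "\<beta> \<sim> \<alpha>"
    using c car A.ring_associated_iff[of \<beta> \<alpha>] A.m_comm by blast
  then show "PIdl \<alpha> = PIdl \<beta>"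
    using A.associated_iff_same_ideal car by blast
qed

text \<open>Conjugation inverts polar classes, so invariance of \<open>pB\<close> makes the class of
  \<open>p\<close> its own inverse; triviality of this class means that \<open>p\<close> is real up
  to a unit.\<close>

lemma square_torsion_free_imp_invariant_irreducibles_real:
  assumes stf: "square_torsion_free (polar_group A)"
  shows invariant_irreducibles_real
  unfolding invariant_irreducibles_real_def
proof (intro ballI impI)
  fix p assume p: "p \<in> carrier B" and irr: "ring_irreducible\<^bsub>B\<^esub> p \<and> p \<sim>\<^bsub>B\<^esub> bar p"
  have nz: "p \<in> nonzero B"
    using irreducible_nonzero p irr by blast
  have "polar_class A p = inv\<^bsub>polar_group A\<^esub> polar_class A p"
    using polar_class_associated[of p "bar p"] nz irr by (simp add: polar_class_bar)
  then have "polar_class A p \<otimes>\<^bsub>polar_group A\<^esub> polar_class A p = \<one>\<^bsub>polar_group A\<^esub>"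
    using nz P.r_inv[of "polar_class A p"] by simp
  then have "polar_class A p [^]\<^bsub>polar_group A\<^esub> (2::nat) = \<one>\<^bsub>polar_group A\<^esub>"
    using nz by (simp add: numeral_2_eq_2)
  then have "polar_class A p = \<one>\<^bsub>polar_group A\<^esub>"
    using stf nz by (simp add: square_torsion_free_def)
  then obtain u a where "u \<in> Units B" "a \<in> nonzero A" "p = u \<otimes>\<^bsub>B\<^esub> emb a"
    using polar_class_eq_one_iff[OF nz] by blast
  then show "\<exists>a\<in>nonzero A. p \<sim>\<^bsub>B\<^esub> emb a"
    using B.ring_associated_iff[OF p] emb_closed A.nonzero_closed by blast
qed


subsection \<open>Transversals and bases\<close>

text \<open>The two residues modulo 2 contribute one associate class each. Questions about orbits
  become questions about associatedness.\<close>

lemma mem_orbit_iff: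
  assumes "f \<in> carrier B" "g \<in> carrier B"
  shows "g \<in> orbit (Gamma A) (Gamma_act A) f \<longleftrightarrow> g \<sim>\<^bsub>B\<^esub> f \<or> g \<sim>\<^bsub>B\<^esub> bar f"
proof -
  have "carrier (Gamma A) = Units B \<times> {0, 1}"
    by (auto simp: Gamma_def carrier_integer_mod_group)
  moreover have "g \<in> orbit (Gamma A) (Gamma_act A) f \<longleftrightarrow>
      (\<exists>k\<in>carrier (Gamma A). g = Gamma_act A k f)"
    unfolding orbit_def by blast
  ultimately have "g \<in> orbit (Gamma A) (Gamma_act A) f \<longleftrightarrow>
      (\<exists>u\<in>Units B. \<exists>m\<in>{0, 1}. g = u \<otimes>\<^bsub>B\<^esub> Z2_act A m f)"
    by (simp only: split_paired_Bex_Sigma Gamma_act_def prod.case)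
  also have "\<dots> \<longleftrightarrow> (\<exists>u\<in>Units B. g = u \<otimes>\<^bsub>B\<^esub> f) \<or> (\<exists>u\<in>Units B. g = u \<otimes>\<^bsub>B\<^esub> bar f)"
    by (simp add: Z2_act_def) blast
  finally show ?thesis
    by (simp only: B.ring_associated_iff[OF assms(2,1)]
        B.ring_associated_iff[OF assms(2) bar_closed[OF assms(1)]])
qed

lemma Delta1D:
  assumes "t \<in> Delta1 A"
  shows "t \<in> Delta A" "ring_irreducible\<^bsub>B\<^esub> t" "t \<in> nonzero B" "t \<in> carrier B"
  using assms Delta_nonzero[of t] B.nonzero_closed[of t] by (auto simp: Delta1_def)

lemma Delta1_orbit:
  assumes "t \<in> Delta1 A" "s \<in> orbit (Gamma A) (Gamma_act A) t"
  shows "s \<in> Delta1 A"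
proof -
  obtain u m where u: "u \<in> Units B" "s = u \<otimes>\<^bsub>B\<^esub> Z2_act A m t"
    using assms(2) by (auto simp: orbit_def Gamma_def Gamma_act_def)
  define r where "r = Z2_act A m t"
  have r: "r \<in> Delta A" "ring_irreducible\<^bsub>B\<^esub> r" "r \<in> carrier B"
    using Delta1D[OF assms(1)] Delta_bar bar_irreducible by (simp_all add: r_def Z2_act_def)
  have s: "s \<in> carrier B" "s \<sim>\<^bsub>B\<^esub> r"
    using u r B.ring_associated_iff[of s r] by (auto simp: r_def)
  have sD: "s \<in> Delta A"
    by (rule Delta_associated[OF r(1) s])
  moreover have "ring_irreducible\<^bsub>B\<^esub> s"
    by (rule B.associated_irreducible[OF r(3,2) s])
  ultimately show ?thesis
    by (simp add: Delta1_def)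
qed

text \<open>Transitivity of the orbit relation through a common \<open>s\<close>. In the mixed cases
  one of the two relations is conjugated first.\<close>

lemma orbit_eqI:
  assumes "f \<in> carrier B" "g \<in> carrier B" "s \<in> carrier B"
    "s \<sim>\<^bsub>B\<^esub> f \<or> s \<sim>\<^bsub>B\<^esub> bar f" "s \<sim>\<^bsub>B\<^esub> g \<or> s \<sim>\<^bsub>B\<^esub> bar g"
  shows "f \<sim>\<^bsub>B\<^esub> g \<or> f \<sim>\<^bsub>B\<^esub> bar g"
proof -
  have sym: "a \<sim>\<^bsub>B\<^esub> b \<Longrightarrow> b \<sim>\<^bsub>B\<^esub> a" for a b
    by (rule B.associated_sym)
  have tr: "f \<sim>\<^bsub>B\<^esub> b" if "f \<sim>\<^bsub>B\<^esub> a" "a \<sim>\<^bsub>B\<^esub> b" "a \<in> carrier B" "b \<in> carrier B" for a b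
    using B.associated_trans[OF that(1,2)] assms(1) that by blast
  have "bar s \<sim>\<^bsub>B\<^esub> f" if "s \<sim>\<^bsub>B\<^esub> bar f"
    using bar_associated[of s "bar f"] that assms(1,3) by simp
  then have "f \<sim>\<^bsub>B\<^esub> s \<or> f \<sim>\<^bsub>B\<^esub> bar s"
    using assms(4) sym by blast
  moreover have "bar s \<sim>\<^bsub>B\<^esub> bar g \<or> bar s \<sim>\<^bsub>B\<^esub> g"
    using assms(5) bar_associated[of s g] bar_associated[of s "bar g"] assms(2,3) by auto
  ultimately show ?thesis
    using assms(2,3,5) tr[of s] tr[of "bar s"] bar_closed by blast
qed

text \<open>Condition (6) asks for some basis, so a transversal has to be produced. One element is
  chosen from each orbit; uniqueness holds because orbits with a common element coincide.\<close>

lemma transversal_exists: "\<exists>T. transversal A T"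
proof -
  define c where "c = (\<lambda>orb :: ('a \<times> 'a) set. SOME t. t \<in> orb)"
  define T where "T = c ` orbits (Gamma A) (Delta1 A) (Gamma_act A)"
  have ex: "f \<in> orbit (Gamma A) (Gamma_act A) f" if "f \<in> Delta1 A" for f
    using mem_orbit_iff[of f f] Delta1D(4)[OF that] B.associated_refl by blast
  have c: "c orb \<in> orb" if "orb \<in> orbits (Gamma A) (Delta1 A) (Gamma_act A)" for orb
  proof -
    obtain f where "f \<in> Delta1 A" "orb = orbit (Gamma A) (Gamma_act A) f"
      using \<open>orb \<in> _\<close> unfolding orbits_def by blast
    then have "\<exists>f. f \<in> orb"
      using ex by blast
    then show ?thesis
      unfolding c_def by (rule someI_ex)
  qed
  have sub: "T \<subseteq> Delta1 A"
  proof
    fix t assume "t \<in> T"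
    then obtain orb where orb: "orb \<in> orbits (Gamma A) (Delta1 A) (Gamma_act A)" "t = c orb"
      unfolding T_def by blast
    obtain f where f: "f \<in> Delta1 A" "orb = orbit (Gamma A) (Gamma_act A) f"
      using orb(1) unfolding orbits_def by blast
    show "t \<in> Delta1 A"
      using Delta1_orbit[OF f(1)] c[OF orb(1)] orb(2) f(2) by simp
  qed
  have unique: "t = c orb" if orb: "orb \<in> orbits (Gamma A) (Delta1 A) (Gamma_act A)"
    and t: "t \<in> T" "t \<in> orb" for t orb
  proof -
    obtain orb' where orb': "orb' \<in> orbits (Gamma A) (Delta1 A) (Gamma_act A)" "t = c orb'"
      using t(1) unfolding T_def by blast
    obtain f where f: "f \<in> Delta1 A" "orb = orbit (Gamma A) (Gamma_act A) f"
      using orb unfolding orbits_def by blast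
    obtain g where g: "g \<in> Delta1 A" "orb' = orbit (Gamma A) (Gamma_act A) g"
      using orb'(1) unfolding orbits_def by blast
    have tD: "t \<in> Delta1 A"
      using t(1) sub by blast
    have car: "f \<in> carrier B" "g \<in> carrier B" "t \<in> carrier B"
      using f(1) g(1) tD Delta1D(4) by auto
    have "t \<in> orb'"
      using c[OF orb'(1)] orb'(2) by simp
    then have tg: "t \<sim>\<^bsub>B\<^esub> g \<or> t \<sim>\<^bsub>B\<^esub> bar g"
      using mem_orbit_iff[OF car(2,3)] g(2) by simp
    have tf: "t \<sim>\<^bsub>B\<^esub> f \<or> t \<sim>\<^bsub>B\<^esub> bar f"
      using mem_orbit_iff[OF car(1,3)] f(2) t(2) by simp
    have sub': "orbit (Gamma A) (Gamma_act A) f1 \<subseteq> orbit (Gamma A) (Gamma_act A) f2"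
      if D: "f1 \<in> Delta1 A" "f2 \<in> Delta1 A" and t1: "t \<sim>\<^bsub>B\<^esub> f1 \<or> t \<sim>\<^bsub>B\<^esub> bar f1"
        and t2: "t \<sim>\<^bsub>B\<^esub> f2 \<or> t \<sim>\<^bsub>B\<^esub> bar f2" for f1 f2
    proof
      fix s assume s: "s \<in> orbit (Gamma A) (Gamma_act A) f1"
      have scar: "s \<in> carrier B" "f1 \<in> carrier B" "f2 \<in> carrier B"
        using Delta1_orbit[OF D(1) s] D Delta1D(4) by auto
      have sf: "s \<sim>\<^bsub>B\<^esub> f1 \<or> s \<sim>\<^bsub>B\<^esub> bar f1"
        using mem_orbit_iff[OF scar(2,1)] s by blast
      have "f1 \<sim>\<^bsub>B\<^esub> s \<or> f1 \<sim>\<^bsub>B\<^esub> bar s"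
        using orbit_eqI[OF scar(2,1,1) sf] B.associated_refl[OF scar(1)] by blast
      then have "s \<sim>\<^bsub>B\<^esub> f2 \<or> s \<sim>\<^bsub>B\<^esub> bar f2"
        using orbit_eqI[OF scar(1,3,2)] orbit_eqI[OF scar(2,3) car(3) t1 t2] by blast
      then show "s \<in> orbit (Gamma A) (Gamma_act A) f2"
        using mem_orbit_iff[OF scar(3,1)] by blast
    qed
    have "orb = orb'"
      using sub'[OF f(1) g(1) tf tg] sub'[OF g(1) f(1) tg tf] f(2) g(2) by blast
    then show ?thesis
      using orb'(2) by simp
  qed
  have "\<exists>!t. t \<in> T \<and> t \<in> orb" if orb: "orb \<in> orbits (Gamma A) (Delta1 A) (Gamma_act A)" for orb
  proof (rule ex1I[of _ "c orb"])
    show "c orb \<in> T \<and> c orb \<in> orb"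
      using c[OF orb] orb by (simp add: T_def)
  qed (use unique[OF orb] in simp)
  then have "transversal A T"
    unfolding transversal_def using sub by blast
  then show ?thesis
    by blast
qed

text \<open>The valuation at \<open>p\<close> alone does not descend to the polar group, as it may
  be nonzero on real elements. Real elements have equal multiplicity at \<open>p\<close> and
  \<open>bar p\<close>, so the difference does descend; it is identically zero when
  \<open>pB\<close> is invariant.\<close>

definition polar_valuation :: "'a \<times> 'a \<Rightarrow> 'a \<times> 'a \<Rightarrow> int" where
  "polar_valuation p f = int (B.count_factor p f) - int (B.count_factor (bar p) f)"

lemma polar_valuation_mult:
  "f \<in> nonzero B \<Longrightarrow> g \<in> nonzero B \<Longrightarrow>
    polar_valuation p (f \<otimes>\<^bsub>B\<^esub> g) = polar_valuation p f + polar_valuation p g"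
  by (simp add: polar_valuation_def B.count_factor_mult nonzero_def)

lemma polar_valuation_unit: "u \<in> Units B \<Longrightarrow> polar_valuation p u = 0"
  by (simp add: polar_valuation_def B.count_factor_unit)

lemma count_factor_bar:
  assumes p: "p \<in> nonzero B" and f: "f \<in> nonzero B"
  shows "B.count_factor (bar p) (bar f) = B.count_factor p f"
proof -
  have "f \<in> carrier B - {\<zero>\<^bsub>B\<^esub>}"
    using f by (simp add: nonzero_def)
  then show ?thesis
  proof (induction rule: B.nonzero_induct)
    case (unit u)
    then show ?case
      by (simp add: B.count_factor_unit)
  next
    case (irreducible q b)
    have q: "q \<in> nonzero B" and b: "b \<in> nonzero B"
      using irreducible.hyps irreducible_nonzero by (auto simp: nonzero_def)
    have bars: "bar q \<in> carrier B - {\<zero>\<^bsub>B\<^esub>}" "bar b \<in> carrier B - {\<zero>\<^bsub>B\<^esub>}" "bar p \<in> carrier B - {\<zero>\<^bsub>B\<^esub>}"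
      "q \<in> carrier B - {\<zero>\<^bsub>B\<^esub>}" "p \<in> carrier B - {\<zero>\<^bsub>B\<^esub>}"
      using bar_nonzero[OF q] bar_nonzero[OF b] bar_nonzero[OF p] q p by (auto simp: nonzero_def)
    have "B.count_factor (bar p) (bar q) = B.count_factor p q"
      using B.count_factor_irreducible[OF bars(3) _ bar_irreducible[OF irreducible.hyps(1,2)]]
        B.count_factor_irreducible[OF bars(5) irreducible.hyps(1,2)]
        bar_associated[of p q] irreducible.hyps(1) B.nonzero_closed[OF p] by simp
    then show ?case
      using irreducible.IH irreducible.hyps bars
      by (simp add: bar_mult B.count_factor_mult)
  qed
qed

lemma polar_valuation_bar:
  assumes "p \<in> nonzero B" "f \<in> nonzero B"
  shows "polar_valuation p (bar f) = - polar_valuation p f"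
  using count_factor_bar[OF assms] count_factor_bar[of "bar p" f] assms B.nonzero_closed[of p]
  by (simp add: polar_valuation_def)

text \<open>Conjugation reverses the sign of a polar valuation, so its value on a real element
  equals its own negative. Units contribute nothing, and passing from \<open>bar g\<close> to
  \<open>g\<close> restores the sign.\<close>

lemma polar_valuation_cong:
  assumes p: "p \<in> nonzero B" and fg: "f \<in> nonzero B" "g \<in> nonzero B"
    and eq: "polar_class A f = polar_class A g"
  shows "polar_valuation p f = polar_valuation p g"
proof -
  obtain u a where ua: "u \<in> Units B" "a \<in> nonzero A" "f \<otimes>\<^bsub>B\<^esub> bar g = u \<otimes>\<^bsub>B\<^esub> emb a"
    using polar_class_eq_iff[OF fg] eq by blast
  have "polar_valuation p (emb a) = - polar_valuation p (emb a)"
    using polar_valuation_bar[OF p, of "emb a"] ua(2) by simp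
  then have "polar_valuation p (f \<otimes>\<^bsub>B\<^esub> bar g) = 0"
    using ua by (simp add: polar_valuation_mult polar_valuation_unit B.Units_nonzero)
  then show ?thesis
    using p fg by (simp add: polar_valuation_mult polar_valuation_bar)
qed

section \<open>Coordinates with respect to a transversal\<close>

lemma transversalD: "transversal A T \<Longrightarrow> t \<in> T \<Longrightarrow> t \<in> Delta1 A"
  unfolding transversal_def by blast

lemma transversal_unique:
  assumes T: "transversal A T" "s \<in> T" "t \<in> T" and eq: "s \<sim>\<^bsub>B\<^esub> t \<or> s \<sim>\<^bsub>B\<^esub> bar t"
  shows "s = t"
proof -
  have D: "s \<in> Delta1 A" "t \<in> Delta1 A"
    using T transversalD by blast+
  have "s \<in> orbit (Gamma A) (Gamma_act A) t" "t \<in> orbit (Gamma A) (Gamma_act A) t"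
    using mem_orbit_iff[of t s] mem_orbit_iff[of t t] Delta1D(4) D eq B.associated_refl by auto
  moreover have "orbit (Gamma A) (Gamma_act A) t \<in> orbits (Gamma A) (Delta1 A) (Gamma_act A)"
    using D(2) unfolding orbits_def by blast
  ultimately show ?thesis
    using T unfolding transversal_def by blast
qed

text \<open>For \<open>s = t\<close> the value would be \<open>1 - 1\<close> if \<open>s\<close>
  were associated to \<open>bar s\<close>; this is excluded because an invariant irreducible is real
  up to a unit and so not in \<Delta>(B). For \<open>s\<close> different from \<open>t\<close> both
  multiplicities vanish, the orbits being distinct.\<close>

lemma polar_valuation_transversal:
  assumes N: invariant_irreducibles_real and T: "transversal A T" "s \<in> T" "t \<in> T"
  shows "polar_valuation s t = (if s = t then 1 else 0)"
proof -
  have D: "s \<in> Delta1 A" "t \<in> Delta1 A"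
    using T transversalD by blast+
  note s = Delta1D[OF D(1)] and t = Delta1D[OF D(2)]
  have nz: "s \<in> carrier B - {\<zero>\<^bsub>B\<^esub>}" "bar s \<in> carrier B - {\<zero>\<^bsub>B\<^esub>}"
    using s(3) bar_nonzero[OF s(3)] by (auto simp: nonzero_def)
  have "\<not> s \<sim>\<^bsub>B\<^esub> bar s"
    using N s irreducible_in_Delta_iff[OF s(4,2)] unfolding invariant_irreducibles_real_def by blast
  moreover have "bar s \<sim>\<^bsub>B\<^esub> t \<longleftrightarrow> s \<sim>\<^bsub>B\<^esub> bar t"
    using bar_associated[of s "bar t"] s(4) t(4) by simp
  ultimately show ?thesis
    using transversal_unique[OF T] s(4)
    by (auto simp: polar_valuation_def B.count_factor_irreducible[OF nz(1) t(4,2)]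
        B.count_factor_irreducible[OF nz(2) t(4,2)])
qed

text \<open>Allows the coefficient of a formal sum at the generator \<open>polar_class A t\<close>
  to be attributed to the element \<open>t\<close> itself.\<close>

lemma transversal_inj:
  assumes N: invariant_irreducibles_real and T: "transversal A T" "s \<in> T" "t \<in> T"
    and eq: "polar_class A s = polar_class A t"
  shows "s = t"
proof -
  have "s \<in> nonzero B" "t \<in> nonzero B"
    using Delta1D(3)[OF transversalD[OF T(1)]] T(2,3) by blast+
  then have "polar_valuation s s = polar_valuation s t"
    using polar_valuation_cong[OF _ _ _ eq] by blast
  then show ?thesis
    using polar_valuation_transversal[OF N T(1,2,2)] polar_valuation_transversal[OF N T]
    by (simp split: if_splits)
qed

text \<open>The universal property supplies \<open>h\<close>. Polar valuations read off the
  coefficients of a formal sum from its image, which gives injectivity; factoring an element into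
  irreducibles gives surjectivity.\<close>

lemma transversal_is_free_basis:
  assumes N: invariant_irreducibles_real and T: "transversal A T"
  shows "is_free_basis (polar_group A) (polar_class A ` T)"
proof -
  define S where "S = polar_class A ` T"
  have TD: "t \<in> nonzero B" if "t \<in> T" for t
    by (rule Delta1D(3)[OF transversalD[OF T that]])
  have S: "S \<subseteq> carrier (polar_group A)"
    using TD by (auto simp: S_def)
  obtain h where h: "h \<in> hom (free_Abelian_group S) (polar_group A)"
    "\<And>s. s \<in> S \<Longrightarrow> h (frag_of s) = s"
    using P.free_Abelian_group_universal[of "\<lambda>s. s" S] S by auto
  interpret h: group_hom "free_Abelian_group S" "polar_group A" h
    using h(1) P.is_group by (simp add: group_hom_def group_hom_axioms_def)
  \<comment> \<open>Valuations are functions of elements of \<open>B\<close>, not of classes, so the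
    induction carries along a representative \<open>f\<close> of \<open>h x\<close> whose valuations
    are the coefficients of \<open>x\<close>.\<close>
  have coeff: "\<exists>f\<in>nonzero B. h x = polar_class A f \<and>
      (\<forall>t\<in>T. Poly_Mapping.lookup x (polar_class A t) = polar_valuation t f)"
    if "Poly_Mapping.keys x \<subseteq> S" for x
    using that
  proof (induction rule: free_Abelian_group_induct[consumes 1, case_names zero diff generator])
    case zero
    have "h 0 = polar_class A \<one>\<^bsub>B\<^esub>"
      using h.hom_one by (simp add: polar_class_one)
    then show ?case
      by (intro bexI[of _ "\<one>\<^bsub>B\<^esub>"]) (simp_all add: polar_valuation_unit)
  next
    case (diff x y)
    then obtain f g where fg: "f \<in> nonzero B" "g \<in> nonzero B"
      "h x = polar_class A f" "h y = polar_class A g"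
      "\<forall>t\<in>T. Poly_Mapping.lookup x (polar_class A t) = polar_valuation t f"
      "\<forall>t\<in>T. Poly_Mapping.lookup y (polar_class A t) = polar_valuation t g"
      by blast
    \<comment> \<open>The representative of a difference is \<open>f * bar g\<close>: conjugation
      both inverts the class of \<open>g\<close> and negates its valuations.\<close>
    have "h (x - y) = h x \<otimes>\<^bsub>polar_group A\<^esub> h (- y)"
      using h.hom_mult[of x "- y"] diff(1,2) by simp
    also have "h (- y) = inv\<^bsub>polar_group A\<^esub> h y"
      using h.hom_inv[of y] diff(2) by simp
    finally have "h (x - y) = polar_class A (f \<otimes>\<^bsub>B\<^esub> bar g)"
      using fg by (simp add: polar_class_mult polar_class_bar)
    moreover have "\<forall>t\<in>T. Poly_Mapping.lookup (x - y) (polar_class A t) =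
        polar_valuation t (f \<otimes>\<^bsub>B\<^esub> bar g)"
      using fg TD by (simp add: polar_valuation_mult polar_valuation_bar lookup_minus)
    ultimately show ?case
      using fg(1,2) by (intro bexI[of _ "f \<otimes>\<^bsub>B\<^esub> bar g"]) simp_all
  next
    case (generator s)
    then obtain t where t: "t \<in> T" "s = polar_class A t"
      by (auto simp: S_def)
    have "Poly_Mapping.lookup (frag_of s) (polar_class A t') = polar_valuation t' t" if "t' \<in> T" for t'
      using transversal_inj[OF N T that t(1)] polar_valuation_transversal[OF N T that t(1)] t(2)
      by (auto split: if_splits)
    then show ?case
      using h(2)[OF generator] t TD by (intro bexI[of _ t]) simp_all
  qed
  have inj: "inj_on h (carrier (free_Abelian_group S))"
    unfolding h.inj_on_one_iff
  proof (intro ballI impI allI)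
    fix x assume x: "x \<in> carrier (free_Abelian_group S)" "h x = \<one>\<^bsub>polar_group A\<^esub>"
    have "Poly_Mapping.keys x \<subseteq> S"
      using x(1) by simp
    then obtain f where f: "f \<in> nonzero B" "h x = polar_class A f"
      "\<forall>t\<in>T. Poly_Mapping.lookup x (polar_class A t) = polar_valuation t f"
      using coeff by blast
    have "polar_valuation t f = 0" if "t \<in> T" for t
      using polar_valuation_cong[of t f "\<one>\<^bsub>B\<^esub>"] TD[OF that] f x(2)
      by (simp add: polar_class_one polar_valuation_unit)
    then have "Poly_Mapping.lookup x s = 0" if "s \<in> S" for s
      using that f(3) by (auto simp: S_def)
    then have "Poly_Mapping.lookup x s = 0" for s
      using x(1) by (cases "s \<in> S") (auto simp: in_keys_iff)
    then show "x = \<one>\<^bsub>free_Abelian_group S\<^esub>"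
      by (simp add: poly_mapping_eqI)
  qed
  \<comment> \<open>The image is a subgroup, so it is enough to reach units and irreducibles. An
    irreducible outside \<Delta>(B) is real up to a unit and has trivial class; any other has a
    member of \<open>T\<close> in its orbit, whose class agrees with its own up to
    inversion.\<close>
  have "polar_class A f \<in> h ` carrier (free_Abelian_group S)" if "f \<in> nonzero B" for f
  proof -
    interpret I: subgroup "h ` carrier (free_Abelian_group S)" "polar_group A"
      by (rule h.img_is_subgroup)
    have unit_class: "polar_class A u \<in> h ` carrier (free_Abelian_group S)" if "u \<in> Units B" for u
      using polar_class_unit_mult[OF that B.nonzero_one] that I.one_closed
      by (simp add: polar_class_one B.Units_closed)
    have "f \<in> carrier B - {\<zero>\<^bsub>B\<^esub>}"
      using that by (simp add: nonzero_def)
    then show ?thesis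
    proof (induction rule: B.nonzero_induct)
      case (unit u)
      then show ?case
        by (rule unit_class)
    next
      case (irreducible p b)
      have p: "p \<in> nonzero B" "p \<in> carrier B" "ring_irreducible\<^bsub>B\<^esub> p" and b: "b \<in> nonzero B"
        using irreducible.hyps irreducible_nonzero by (auto simp: nonzero_def)
      have "polar_class A p \<in> h ` carrier (free_Abelian_group S)"
      proof (cases "p \<in> Delta A")
        case False
        then obtain a where a: "a \<in> nonzero A" "p \<sim>\<^bsub>B\<^esub> emb a"
          using irreducible_in_Delta_iff p by blast
        have "polar_class A p = polar_class A (emb a)"
          by (rule polar_class_associated[OF p(1) emb_nonzero[OF a(1)] a(2)])
        also have "\<dots> = polar_class A \<one>\<^bsub>B\<^esub>"
          using polar_class_emb_mult[OF a(1) B.nonzero_one] emb_closed[OF A.nonzero_closed[OF a(1)]]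
          by simp
        finally show ?thesis
          using I.one_closed by (simp add: polar_class_one)
      next
        case True
        then have pD: "p \<in> Delta1 A"
          using p by (simp add: Delta1_def)
        then have "orbit (Gamma A) (Gamma_act A) p \<in> orbits (Gamma A) (Delta1 A) (Gamma_act A)"
          unfolding orbits_def by blast
        then obtain t where t: "t \<in> T" "t \<in> orbit (Gamma A) (Gamma_act A) p"
          using T unfolding transversal_def by blast
        have tp: "t \<sim>\<^bsub>B\<^esub> p \<or> t \<sim>\<^bsub>B\<^esub> bar p"
          using mem_orbit_iff[OF p(2) B.nonzero_closed[OF TD[OF t(1)]]] t(2) by blast
        have "polar_class A t = h (frag_of (polar_class A t))"
          using h(2) t(1) by (simp add: S_def)
        then have tI: "polar_class A t \<in> h ` carrier (free_Abelian_group S)"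
          by (rule image_eqI) (simp add: S_def t(1))
        have "polar_class A p = polar_class A t \<or> polar_class A p = inv\<^bsub>polar_group A\<^esub> polar_class A t"
          using tp
        proof
          assume "t \<sim>\<^bsub>B\<^esub> p"
          then show ?thesis
            using polar_class_associated[OF TD[OF t(1)] p(1)] by simp
        next
          assume "t \<sim>\<^bsub>B\<^esub> bar p"
          then show ?thesis
            using polar_class_associated[OF TD[OF t(1)] bar_nonzero[OF p(1)]] p(1)
            by (simp add: polar_class_bar)
        qed
        then show ?thesis
          using tI I.m_inv_closed[OF tI] by auto
      qed
      then show ?case
        using irreducible.IH p b by (simp add: polar_class_mult)
    qed
  qed
  then have "h ` carrier (free_Abelian_group S) = carrier (polar_group A)"
    using h.hom_closed unfolding carrier_polar_group by blast
  then have "h \<in> iso (free_Abelian_group S) (polar_group A)"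
    using h(1) inj by (simp add: iso_def bij_betw_def)
  then show ?thesis
    using S h(2) unfolding is_free_basis_def S_def by blast
qed

section \<open>Assembly of the equivalences\<close>

lemma unique_polar_factorization_iff:
  "(\<forall>f\<in>nonzero B. has_unique_polar_factorization A f) \<longleftrightarrow> invariant_irreducibles_real"
  using unique_polar_factorization_imp_separate separate_imp_unique_polar_factorization
    separate_imp_invariant_irreducibles_real invariant_irreducibles_real_imp_separate
  by blast

lemma Delta_iff_coprime_iff: "Delta_iff_coprime \<longleftrightarrow> invariant_irreducibles_real"
  using invariant_irreducibles_real_imp_Delta_iff_coprime
    Delta_iff_coprime_imp_invariant_irreducibles_real by blast

lemma polar_classes_separate_iff: "polar_classes_separate_ideals \<longleftrightarrow> invariant_irreducibles_real"
  using separate_imp_invariant_irreducibles_real invariant_irreducibles_real_imp_separate by blast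

lemma free_abelian_imp_torsion_free:
  "is_free_abelian (polar_group A) \<Longrightarrow> torsion_free (polar_group A)"
  using free_basis_imp_torsion_free P.is_group unfolding is_free_abelian_def by blast

lemma invariant_irreducibles_real_imp_free_abelian:
  assumes invariant_irreducibles_real
  shows "is_free_abelian (polar_group A)"
proof -
  obtain T where "transversal A T"
    using transversal_exists by blast
  then show ?thesis
    using transversal_is_free_basis[OF assms] comm_group_polar unfolding is_free_abelian_def by blast
qed

text \<open>A single cycle yields all three: a free abelian group is torsion free, hence
  square-torsion free, which makes invariant irreducibles real, and a transversal then gives a
  basis.\<close>

lemma square_torsion_free_iff:
  "square_torsion_free (polar_group A) \<longleftrightarrow> invariant_irreducibles_real"
  and torsion_free_iff: "torsion_free (polar_group A) \<longleftrightarrow> invariant_irreducibles_real"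
  and free_abelian_iff: "is_free_abelian (polar_group A) \<longleftrightarrow> invariant_irreducibles_real"
  using square_torsion_free_imp_invariant_irreducibles_real torsion_free_imp_square_torsion_free
    free_abelian_imp_torsion_free invariant_irreducibles_real_imp_free_abelian by blast+

end

text \<open>The image of the real number \<open>1/2\<close> is the inverse of \<open>1 + 1\<close>
  in \<open>A\<close>.\<close>

lemma complexified_ufd_over_reals:
  assumes A: "domain A" and \<rho>: "\<rho> \<in> ring_hom (ring_of_type_algebra :: real ring) A"
    and B: "factorial_domain (complexify A)"
  shows "complexified_ufd A"
proof -
  interpret A: domain A by (rule A)
  have half: "\<rho> (1/2) \<in> carrier A"
    using ring_hom_closed[OF \<rho>, of "1/2"] by (simp add: ring_of_type_algebra_def)
  have "\<rho> (1/2) \<oplus>\<^bsub>A\<^esub> \<rho> (1/2) = \<rho> 1"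
    using ring_hom_add[OF \<rho>, of "1/2" "1/2"] by (simp add: ring_of_type_algebra_def)
  also have "\<dots> = \<one>\<^bsub>A\<^esub>"
    using ring_hom_one[OF \<rho>] by (simp add: ring_of_type_algebra_def)
  finally have two: "(\<one>\<^bsub>A\<^esub> \<oplus>\<^bsub>A\<^esub> \<one>\<^bsub>A\<^esub>) \<otimes>\<^bsub>A\<^esub> \<rho> (1/2) = \<one>\<^bsub>A\<^esub>"
    using half by (simp add: A.l_distr)
  moreover from two have "\<rho> (1/2) \<otimes>\<^bsub>A\<^esub> (\<one>\<^bsub>A\<^esub> \<oplus>\<^bsub>A\<^esub> \<one>\<^bsub>A\<^esub>) = \<one>\<^bsub>A\<^esub>"
    using half by (simp add: A.m_comm)
  ultimately have "\<one>\<^bsub>A\<^esub> \<oplus>\<^bsub>A\<^esub> \<one>\<^bsub>A\<^esub> \<in> Units A"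
    unfolding Units_def using half by blast
  then show ?thesis
    using A B by (simp add: complexified_ufd_def complexified_ufd_axioms_def
        unique_factorization_domain_def factorial_domain_def)
qed

theorem theorem5p1:
  fixes A :: "('a, 'm) ring_scheme" and \<rho> :: "real \<Rightarrow> 'a"
  assumes "noetherian_domain A"
    and "\<rho> \<in> ring_hom (ring_of_type_algebra :: real ring) A" and "inj \<rho>"
    and "\<forall>x \<in> carrier A. (ring.algebraic A over (range \<rho>)) x \<longrightarrow> x \<in> range \<rho>"
    and "domain (complexify A)"
    and "factorial_domain (complexify A)"
  shows "all_equivalent
      [\<forall>f \<in> nonzero (complexify A). has_unique_polar_factorization A f,
       \<forall>f \<in> nonzero (complexify A). f \<in> Delta A \<longleftrightarrow>
         \<one>\<^bsub>complexify A\<^esub> gcdof\<^bsub>complexify A\<^esub> f (conjugate A f),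
       \<forall>f \<in> Delta A. \<forall>g \<in> Delta A. polar_class A f = polar_class A g \<longleftrightarrow>
         PIdl\<^bsub>complexify A\<^esub> f = PIdl\<^bsub>complexify A\<^esub> g,
       square_torsion_free (polar_group A),
       torsion_free (polar_group A),
       is_free_abelian (polar_group A)]
    \<and> (is_free_abelian (polar_group A) \<longrightarrow>
        (\<forall>T. transversal A T \<longrightarrow> is_free_basis (polar_group A) (polar_class A ` T)))"
proof -
  interpret complexified_ufd A
    using complexified_ufd_over_reals assms(1,2,6) unfolding noetherian_domain_def by blast
  have "is_free_basis (polar_group A) (polar_class A ` T)"
    if "is_free_abelian (polar_group A)" "transversal A T" for T
    using transversal_is_free_basis that free_abelian_iff by blast
  then show ?thesis
    using unique_polar_factorization_iff Delta_iff_coprime_iff[unfolded Delta_iff_coprime_def]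
      polar_classes_separate_iff[unfolded polar_classes_separate_ideals_def]
      square_torsion_free_iff torsion_free_iff free_abelian_iff
    by (simp add: all_equivalent_def)
qed

end
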